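(* Let $M$ be a nonzero right module over a ring $R$, and let $\mathcal{P}$ be the set of square matrices $A$ over $R$ such that, if $A$ is $n\times n$, $A$ gives a non-surjective map $M^n\to M^n$. Then, with conditions (P1)–(P7) and (E') on a set of square matrices as defined in the context: (i) $\mathcal{P}$ satisfies (P2), (P5), (P6), (P7) and (E'). (ii) A necessary and sufficient condition for $\mathcal{P}$ to satisfy (P1) is: (A') no $(n-1)\times n$ matrix over $R$ induces a surjection of abelian groups $M^{n-1}\to M^n$ $(n>0)$. (iii) A sufficient condition for $\mathcal{P}$ to satisfy (P4) is: (B') if $I\subseteq M^n$ ($n>0$) is the image of $M^{n-1}$ under the action of an $(n-1)\times n$ matrix over $R$, then either (a) every map $M\to M^n$ which is determined by a length-$n$ row vector over $R$ and has image not contained in $I$ has image which, together with $I$, spans the additive group of $M^n$, or (b) no such map has image which, together with $I$, spans that additive group. Thus, if both (A') and (B') hold, then $\mathcal{P}$ is a prime matrix ideal of $R$. Hence if, further, every nonzero element of $R$ carries $M$ surjectively to itself, then $R$ is embeddable in a division ring.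
   Context: Rings are associative with $1$, not necessarily commutative; ring homomorphisms preserve $1$; modules are unital. "Embeddable in a division ring" means there is an injective ring homomorphism into a division ring. Elements of $M^n$ are row vectors, on which $n\times n'$ matrices over $R$ act on the right, giving additive group homomorphisms $M^n\to M^{n'}$; in particular a length-$n$ row vector (a $1\times n$ matrix) determines a map $M\to M^n$. For $n=1$, an $(n-1)\times n$ matrix is the empty $0\times 1$ matrix, inducing the zero map $M^0=\{0\}\to M$. For square matrices $A,B$, $A\oplus B=\begin{pmatrix}A&0\\0&B\end{pmatrix}$. If $A,B$ are square matrices of the same size agreeing except in their $r$-th column (resp. row), the determinantal sum $A\nabla B$ with respect to that column (row) agrees with $A$ and $B$ in all other columns (rows) and has as $r$-th column (row) the sum of those of $A$ and $B$. Conditions on a set $\mathcal{P}$ of square matrices over $R$: (P1) $\mathcal{P}$ contains every $n\times n$ matrix ($n>0$) that can be written as the product of an $n\times (n-1)$ matrix and an $(n-1)\times n$ matrix over $R$. (P2) If $A\in\mathcal{P}$ and $B$ is any square matrix over $R$, then $A\oplus B\in\mathcal{P}$. (P3) If $\mathcal{P}$ contains $n\times n$ matrices $A$, $B$ agreeing except in the $r$-th column for some $r$, then it contains $A\nabla B$ with respect to that column. (P4) If $\mathcal{P}$ contains $n\times n$ matrices $A$, $B$ agreeing except in the $r$-th row for some $r$, then it contains $A\nabla B$ with respect to that row. (P5) If $A\oplus 1\in\mathcal{P}$, where $1$ is the $1\times 1$ matrix with entry $1$, then $A\in\mathcal{P}$. (P6) The $1\times 1$ matrix $1$ is not in $\mathcal{P}$.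 (P7) If $A\oplus B\in\mathcal{P}$, then $A\in\mathcal{P}$ or $B\in\mathcal{P}$. (E') For each $n>0$, the set of $n\times n$ matrices in $\mathcal{P}$ is closed under right multiplication by the matrices $I_n\pm e_{ij}$ $(i\neq j)$, where $e_{ij}$ are matrix units. A prime matrix ideal of $R$ is a set of square matrices over $R$ satisfying (P1)–(P7). *)

theory Defs
  imports "Jordan_Normal_Form.VS_Connect" "HOL-Algebra.Generated_Groups"
begin

text \<open>
  The ring and the underlying group of the module are types of class \<^class>\<open>ring_1\<close> (associative,
  unital, not necessarily commutative) and \<^class>\<open>ab_group_add\<close>. The class \<^class>\<open>ring_1\<close> excludes
  the zero ring, which has no nonzero unital module.
\<close>

locale right_module =
  fixes act :: "'m::ab_group_add \<Rightarrow> 'r::ring_1 \<Rightarrow> 'm"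
  assumes act_add_left: "act (x + y) r = act x r + act y r"
    and act_add_right: "act x (r + s) = act x r + act x s"
    and act_mult: "act x (r * s) = act (act x r) s"
    and act_one: "act x 1 = x"

text \<open>
  The group \<open>M^n\<close> is \<^term>\<open>carrier_vec n :: 'm vec set\<close>, viewed as row vectors. Indices are 0-based,
  and matrices with no rows or no columns are allowed; in particular the 0-by-0 matrix is square.
\<close>

definition mat_act ::
    "('m::ab_group_add \<Rightarrow> 'r::ring_1 \<Rightarrow> 'm) \<Rightarrow> 'r mat \<Rightarrow> 'm vec \<Rightarrow> 'm vec" where
  "mat_act act A v = vec (dim_col A) (\<lambda>j. \<Sum>i<dim_row A. act (v $ i) (A $$ (i, j)))"

definition mat_image ::
    "('m::ab_group_add \<Rightarrow> 'r::ring_1 \<Rightarrow> 'm) \<Rightarrow> 'r mat \<Rightarrow> 'm vec set" where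
  "mat_image act A = mat_act act A ` carrier_vec (dim_row A)"

definition mat_surj :: "('m::ab_group_add \<Rightarrow> 'r::ring_1 \<Rightarrow> 'm) \<Rightarrow> 'r mat \<Rightarrow> bool" where
  "mat_surj act A \<longleftrightarrow> mat_image act A = carrier_vec (dim_col A)"

definition nonsurj_mats :: "('m::ab_group_add \<Rightarrow> 'r::ring_1 \<Rightarrow> 'm) \<Rightarrow> 'r mat set" where
  "nonsurj_mats act = {A. square_mat A \<and> \<not> mat_surj act A}"

definition row_image ::
    "('m::ab_group_add \<Rightarrow> 'r::ring_1 \<Rightarrow> 'm) \<Rightarrow> 'r vec \<Rightarrow> 'm vec set" where
  "row_image act u = range (\<lambda>x. map_vec (act x) u)"

definition spans_with :: "nat \<Rightarrow> 'm::ab_group_add vec set \<Rightarrow> 'm vec set \<Rightarrow> bool" where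
  "spans_with n S I \<longleftrightarrow> generate (monoid_vec TYPE('m) n) (S \<union> I) = carrier_vec n"


definition mat_dsum :: "'r::zero mat \<Rightarrow> 'r mat \<Rightarrow> 'r mat" (infixr "\<oplus>\<^sub>d" 65) where
  "A \<oplus>\<^sub>d B = four_block_mat A (0\<^sub>m (dim_row A) (dim_col B)) (0\<^sub>m (dim_row B) (dim_col A)) B"

definition agree_off_col :: "nat \<Rightarrow> 'r mat \<Rightarrow> 'r mat \<Rightarrow> bool" where
  "agree_off_col r A B \<longleftrightarrow> (\<forall>i<dim_row A. \<forall>j<dim_col A. j \<noteq> r \<longrightarrow> A $$ (i, j) = B $$ (i, j))"

definition agree_off_row :: "nat \<Rightarrow> 'r mat \<Rightarrow> 'r mat \<Rightarrow> bool" where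
  "agree_off_row r A B \<longleftrightarrow> (\<forall>i<dim_row A. \<forall>j<dim_col A. i \<noteq> r \<longrightarrow> A $$ (i, j) = B $$ (i, j))"

definition det_sum_col :: "nat \<Rightarrow> 'r::plus mat \<Rightarrow> 'r mat \<Rightarrow> 'r mat" where
  "det_sum_col r A B = mat (dim_row A) (dim_col A)
     (\<lambda>(i, j). if j = r then A $$ (i, j) + B $$ (i, j) else A $$ (i, j))"

definition det_sum_row :: "nat \<Rightarrow> 'r::plus mat \<Rightarrow> 'r mat \<Rightarrow> 'r mat" where
  "det_sum_row r A B = mat (dim_row A) (dim_col A)
     (\<lambda>(i, j). if i = r then A $$ (i, j) + B $$ (i, j) else A $$ (i, j))"

definition mat_unit :: "nat \<Rightarrow> nat \<Rightarrow> nat \<Rightarrow> 'r::zero_neq_one mat" where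
  "mat_unit n i j = mat n n (\<lambda>(k, l). if k = i \<and> l = j then 1 else 0)"


definition P1 :: "'r::ring_1 mat set \<Rightarrow> bool" where
  "P1 P \<longleftrightarrow> (\<forall>n>0. \<forall>B \<in> carrier_mat n (n - 1). \<forall>C \<in> carrier_mat (n - 1) n. B * C \<in> P)"

definition P2 :: "'r::ring_1 mat set \<Rightarrow> bool" where
  "P2 P \<longleftrightarrow> (\<forall>A \<in> P. \<forall>B. square_mat B \<longrightarrow> A \<oplus>\<^sub>d B \<in> P)"

definition P3 :: "'r::ring_1 mat set \<Rightarrow> bool" where
  "P3 P \<longleftrightarrow> (\<forall>n r. \<forall>A \<in> P \<inter> carrier_mat n n. \<forall>B \<in> P \<inter> carrier_mat n n.
     r < n \<longrightarrow> agree_off_col r A B \<longrightarrow> det_sum_col r A B \<in> P)"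

definition P4 :: "'r::ring_1 mat set \<Rightarrow> bool" where
  "P4 P \<longleftrightarrow> (\<forall>n r. \<forall>A \<in> P \<inter> carrier_mat n n. \<forall>B \<in> P \<inter> carrier_mat n n.
     r < n \<longrightarrow> agree_off_row r A B \<longrightarrow> det_sum_row r A B \<in> P)"

definition P5 :: "'r::ring_1 mat set \<Rightarrow> bool" where
  "P5 P \<longleftrightarrow> (\<forall>A. square_mat A \<longrightarrow> A \<oplus>\<^sub>d 1\<^sub>m 1 \<in> P \<longrightarrow> A \<in> P)"

definition P6 :: "'r::ring_1 mat set \<Rightarrow> bool" where
  "P6 P \<longleftrightarrow> 1\<^sub>m 1 \<notin> P"

definition P7 :: "'r::ring_1 mat set \<Rightarrow> bool" where
  "P7 P \<longleftrightarrow> (\<forall>A B. square_mat A \<longrightarrow> square_mat B \<longrightarrow> A \<oplus>\<^sub>d B \<in> P \<longrightarrow> A \<in> P \<or> B \<in> P)"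

definition cond_E' :: "'r::ring_1 mat set \<Rightarrow> bool" where
  "cond_E' P \<longleftrightarrow> (\<forall>n>0. \<forall>A \<in> P \<inter> carrier_mat n n. \<forall>i<n. \<forall>j<n. i \<noteq> j \<longrightarrow>
     A * (1\<^sub>m n + mat_unit n i j) \<in> P \<and> A * (1\<^sub>m n - mat_unit n i j) \<in> P)"

definition prime_matrix_ideal :: "'r::ring_1 mat set \<Rightarrow> bool" where
  "prime_matrix_ideal P \<longleftrightarrow>
     (\<forall>A \<in> P. square_mat A) \<and> P1 P \<and> P2 P \<and> P3 P \<and> P4 P \<and> P5 P \<and> P6 P \<and> P7 P"


definition cond_A' :: "('m::ab_group_add \<Rightarrow> 'r::ring_1 \<Rightarrow> 'm) \<Rightarrow> bool" where
  "cond_A' act \<longleftrightarrow> (\<forall>n>0. \<forall>C \<in> carrier_mat (n - 1) n. \<not> mat_surj act C)"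

definition cond_B' :: "('m::ab_group_add \<Rightarrow> 'r::ring_1 \<Rightarrow> 'm) \<Rightarrow> bool" where
  "cond_B' act \<longleftrightarrow> (\<forall>n>0. \<forall>C \<in> carrier_mat (n - 1) n.
     let I = mat_image act C;
         U = {u \<in> carrier_vec n. \<not> row_image act u \<subseteq> I}
     in (\<forall>u \<in> U. spans_with n (row_image act u) I) \<or>
        (\<forall>u \<in> U. \<not> spans_with n (row_image act u) I))"


locale skew_field = ring +
  assumes one_not_zero: "\<one> \<noteq> \<zero>"
    and skew_field_Units: "Units R = carrier R - {\<zero>}"

text \<open>
  HOL cannot quantify existentially over types, so the elements of the division ring are taken from
  \<^typ>\<open>'r mat set\<close>. This loses nothing: if \<open>R\<close> embeds in any division ring, then the division
  subring generated by the image of \<open>R\<close> has at most as many elements as the infinite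
  type \<^typ>\<open>'r mat\<close>, so it has an isomorphic copy on a subset of \<^typ>\<open>'r mat set\<close>.
\<close>

definition embeddable_in_division_ring :: "'r::ring_1 itself \<Rightarrow> bool" where
  "embeddable_in_division_ring _ \<longleftrightarrow>
     (\<exists>(D :: 'r mat set ring) h. skew_field D \<and> h \<in> Ring.ring_hom (class_ring :: 'r ring) D \<and> inj h)"

end

theory Submission
  imports Defs "Jordan_Normal_Form.Determinant"
begin

text \<open>
  A square matrix that is onto \<open>M^n\<close> plays the role of an invertible one. If \<open>A\<close> has one column more
  than it has rows and becomes onto after adjoining the row \<open>w\<close>, then solving \<open>x u + y w \<in> im A\<close> for \<open>y\<close>
  gives an everywhere defined additive relation on \<open>M\<close>, multivalued in general. These relations are
  closed under sums and composition, and under converse when they are onto. Conditions (A') and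
  (B') imply that a sum of two relations that are not onto is not onto, and (A') that no relation
  sends \<open>0\<close> to all of \<open>M\<close>. Identifying two relations whose difference is not onto therefore gives a
  division ring; \<open>R\<close> maps into it by scalar multiplication, injectively if every nonzero scalar is
  onto. The same relations give (P3): an exchange argument turns surjectivity of \<open>A\<close>, \<open>B\<close> and
  \<open>A \<nabla> B\<close> into surjectivity of relations \<open>f\<close>, \<open>g\<close> and \<open>h\<close> with \<open>h \<subseteq> f + g\<close>.
\<close>

section \<open>Division rings of additive relations\<close>

definition rel_plus :: "('m::ab_group_add \<times> 'm) set \<Rightarrow> ('m \<times> 'm) set \<Rightarrow> ('m \<times> 'm) set" where
  "rel_plus f g = {(x, y). \<exists>z. (x, z) \<in> f \<and> (x, y - z) \<in> g}"

definition rel_neg :: "('m::ab_group_add \<times> 'm) set \<Rightarrow> ('m \<times> 'm) set" where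
  "rel_neg f = {(x, y). (x, - y) \<in> f}"

definition rel_zero :: "('m::ab_group_add \<times> 'm) set" where
  "rel_zero = {(x, y). y = 0}"

text \<open>For a multivalued additive \<open>f\<close>, subtracting \<open>f\<close> from itself
  yields all values of \<open>f\<close> at 0, so equality cannot be tested by a vanishing
  difference. Failing to be onto replaces vanishing.\<close>

definition rel_sim :: "('m::ab_group_add \<times> 'm) set \<Rightarrow> ('m \<times> 'm) set \<Rightarrow> bool" where
  "rel_sim f g \<longleftrightarrow> Range (rel_plus f (rel_neg g)) \<noteq> UNIV"

lemma rel_plus_iff [simp]: "(x, y) \<in> rel_plus f g \<longleftrightarrow> (\<exists>z. (x, z) \<in> f \<and> (x, y - z) \<in> g)"
  by (simp add: rel_plus_def)

lemma rel_neg_iff [simp]: "(x, y) \<in> rel_neg f \<longleftrightarrow> (x, - y) \<in> f"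
  by (simp add: rel_neg_def)

lemma rel_zero_iff [simp]: "(x, y) \<in> rel_zero \<longleftrightarrow> y = 0"
  by (simp add: rel_zero_def)

lemma rel_plusI: "(x, y) \<in> f \<Longrightarrow> (x, z) \<in> g \<Longrightarrow> (x, y + z) \<in> rel_plus f g"
  by (auto intro!: exI[of _ y])

lemma rel_eqI: "(\<And>x y. (x, y) \<in> f \<longleftrightarrow> (x, y) \<in> g) \<Longrightarrow> f = g"
  by auto

lemma rel_plus_commute: "rel_plus f g = rel_plus g f"
proof -
  have "rel_plus f g \<subseteq> rel_plus g f" for f g :: "('m::ab_group_add \<times> 'm) set"
  proof clarify
    fix x y assume "(x, y) \<in> rel_plus f g"
    then obtain z where "(x, z) \<in> f" "(x, y - z) \<in> g" by auto
    then have "(x, (y - z) + z) \<in> rel_plus g f" by (intro rel_plusI)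
    then show "(x, y) \<in> rel_plus g f" by simp
  qed
  then show ?thesis by blast
qed

lemma rel_plus_assoc: "rel_plus (rel_plus f g) h = rel_plus f (rel_plus g h)"
proof (rule rel_eqI, unfold rel_plus_iff rel_neg_iff, intro iffI; elim exE conjE)
  fix x y z w assume "(x, w) \<in> f" "(x, z - w) \<in> g" "(x, y - z) \<in> h"
  then show "\<exists>a. (x, a) \<in> f \<and> (\<exists>b. (x, b) \<in> g \<and> (x, y - a - b) \<in> h)"
    by (intro exI[of _ w] conjI exI[of _ "z - w"]) (auto simp: algebra_simps)
next
  fix x y z w assume "(x, z) \<in> f" "(x, w) \<in> g" "(x, y - z - w) \<in> h"
  then show "\<exists>a. (\<exists>b. (x, b) \<in> f \<and> (x, a - b) \<in> g) \<and> (x, y - a) \<in> h"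
    by (intro exI[of _ "z + w"] conjI exI[of _ z]) (auto simp: algebra_simps)
qed

lemma rel_plus_zero: "rel_plus rel_zero f = f" "rel_plus f rel_zero = f"
  by auto

lemma rel_neg_plus: "rel_neg (rel_plus f g) = rel_plus (rel_neg f) (rel_neg g)"
proof (rule rel_eqI, unfold rel_plus_iff rel_neg_iff, intro iffI; elim exE conjE)
  fix x y z assume "(x, z) \<in> f" "(x, - y - z) \<in> g"
  then show "\<exists>z. (x, - z) \<in> f \<and> (x, - (y - z)) \<in> g"
    by (intro exI[of _ "- z"]) (auto simp: algebra_simps)
next
  fix x y z assume "(x, - z) \<in> f" "(x, - (y - z)) \<in> g"
  then show "\<exists>z. (x, z) \<in> f \<and> (x, - y - z) \<in> g"
    by (intro exI[of _ "- z"]) (auto simp: algebra_simps)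
qed

lemma rel_neg_neg [simp]: "rel_neg (rel_neg f) = f"
  by auto

lemma Range_rel_neg: "Range (rel_neg f) = UNIV \<longleftrightarrow> Range f = UNIV"
proof -
  have "Range (rel_neg f) = UNIV" if "Range f = UNIV" for f :: "('m::ab_group_add \<times> 'm) set"
  proof -
    have "y \<in> Range (rel_neg f)" for y
      using that by (metis Range_iff UNIV_I rel_neg_iff)
    then show ?thesis by blast
  qed
  from this[of f] this[of "rel_neg f"] show ?thesis by auto
qed

lemma rel_sim_zero:
  fixes f :: "('m::ab_group_add \<times> 'm) set"
  shows "rel_sim f rel_zero \<longleftrightarrow> Range f \<noteq> UNIV"
proof -
  have "rel_neg rel_zero = (rel_zero :: ('m::ab_group_add \<times> 'm) set)" by auto
  then show ?thesis by (simp only: rel_sim_def rel_plus_zero)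
qed

lemma rel_sim_sym: "rel_sim f g \<Longrightarrow> rel_sim g f"
  unfolding rel_sim_def
  by (metis Range_rel_neg rel_neg_neg rel_neg_plus rel_plus_commute)

text \<open>
  A relation in \<open>S\<close> is an everywhere defined but possibly multivalued endomorphism. Those which are
  not onto play the role of zero.
\<close>

locale division_relations =
  fixes S :: "('m::ab_group_add \<times> 'm) set set"
  assumes diff: "f \<in> S \<Longrightarrow> (x, y) \<in> f \<Longrightarrow> (x', y') \<in> f \<Longrightarrow> (x - x', y - y') \<in> f"
    and total: "f \<in> S \<Longrightarrow> \<exists>y. (x, y) \<in> f"
    and plus_closed: "f \<in> S \<Longrightarrow> g \<in> S \<Longrightarrow> rel_plus f g \<in> S"
    and neg_closed: "f \<in> S \<Longrightarrow> rel_neg f \<in> S"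
    and comp_closed: "f \<in> S \<Longrightarrow> g \<in> S \<Longrightarrow> f O g \<in> S"
    and converse_closed: "f \<in> S \<Longrightarrow> Range f = UNIV \<Longrightarrow> f\<inverse> \<in> S"
    and Id_closed: "Id \<in> S"
    and zero_closed: "rel_zero \<in> S"
    and indeterminacy: "f \<in> S \<Longrightarrow> f `` {0} \<noteq> UNIV"
    and nonsurj_plus: "f \<in> S \<Longrightarrow> g \<in> S \<Longrightarrow> Range f \<noteq> UNIV \<Longrightarrow> Range g \<noteq> UNIV \<Longrightarrow>
      Range (rel_plus f g) \<noteq> UNIV"
begin

section \<open>Additivity, and similarity as a congruence for sum and composition\<close>

lemma zero_pair: "f \<in> S \<Longrightarrow> (0, 0) \<in> f"
  using diff[of f x y x y for x y] total[of f 0] by fastforce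

lemma neg_pair: "f \<in> S \<Longrightarrow> (x, y) \<in> f \<Longrightarrow> (- x, - y) \<in> f"
  using diff[of f 0 0 x y] zero_pair by simp

lemma add_pair: "f \<in> S \<Longrightarrow> (x, y) \<in> f \<Longrightarrow> (x', y') \<in> f \<Longrightarrow> (x + x', y + y') \<in> f"
  using diff[of f x y "- x'" "- y'"] neg_pair by simp

text \<open>Two values of \<open>g\<close> at one point differ by a value of \<open>g\<close> at 0,
  so the difference has its range among the values of \<open>g\<close> at 0, and these are not
  everything by \<open>indeterminacy\<close>. Several identities below hold only as inclusions; this
  turns them into equalities of classes.\<close>

lemma sim_subset:
  assumes "f \<subseteq> g" "f \<in> S" "g \<in> S"
  shows "rel_sim f g"
proof -
  have "Range (rel_plus f (rel_neg g)) \<subseteq> g `` {0}"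
  proof
    fix y assume "y \<in> Range (rel_plus f (rel_neg g))"
    then obtain x z where "(x, z) \<in> f" "(x, - (y - z)) \<in> g" by auto
    then have "(x - x, z - (z - y)) \<in> g"
      using assms by (intro diff) auto
    then show "y \<in> g `` {0}" by simp
  qed
  then show ?thesis
    unfolding rel_sim_def using indeterminacy[OF assms(3)] by auto
qed

lemma sim_refl: "f \<in> S \<Longrightarrow> rel_sim f f"
  by (simp add: sim_subset)

text \<open>Subtracting and adding back a value of the everywhere defined \<open>g\<close> places f
  - h inside (f - g) + (g - h), a sum of two relations that are not onto.\<close>

lemma sim_trans:
  assumes "rel_sim f g" "rel_sim g h" "f \<in> S" "g \<in> S" "h \<in> S"
  shows "rel_sim f h"
proof -
  let ?s = "rel_plus (rel_plus f (rel_neg g)) (rel_plus g (rel_neg h))"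
  have "Range ?s \<noteq> UNIV"
    using assms by (intro nonsurj_plus[of "rel_plus f (rel_neg g)"])
      (simp_all add: rel_sim_def plus_closed neg_closed)
  moreover have "rel_plus f (rel_neg h) \<subseteq> ?s"
  proof clarify
    fix x y assume "(x, y) \<in> rel_plus f (rel_neg h)"
    then obtain z where z: "(x, z) \<in> f" "(x, y - z) \<in> rel_neg h" by auto
    obtain w where w: "(x, w) \<in> g" using total assms by blast
    have "(x, (z + - w) + (w + (y - z))) \<in> ?s"
      using z w by (intro rel_plusI) auto
    then show "(x, y) \<in> ?s" by simp
  qed
  ultimately show ?thesis
    unfolding rel_sim_def using Range_mono by blast
qed

lemma sim_plus:
  assumes "rel_sim f f'" "rel_sim g g'" "f \<in> S" "f' \<in> S" "g \<in> S" "g' \<in> S"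
  shows "rel_sim (rel_plus f g) (rel_plus f' g')"
proof -
  have "rel_plus (rel_plus f g) (rel_neg (rel_plus f' g')) =
      rel_plus (rel_plus f (rel_neg f')) (rel_plus g (rel_neg g'))"
    by (metis rel_neg_plus rel_plus_assoc rel_plus_commute)
  then show ?thesis
    using assms unfolding rel_sim_def by (simp add: nonsurj_plus plus_closed neg_closed)
qed

text \<open>Not being onto means being similar to \<open>rel_zero\<close>, so it depends only on the
  class.\<close>

lemma nonsurj_sim: "rel_sim f g \<Longrightarrow> f \<in> S \<Longrightarrow> g \<in> S \<Longrightarrow> Range g \<noteq> UNIV \<Longrightarrow> Range f \<noteq> UNIV"
  using sim_trans[of f g rel_zero] zero_closed by (auto simp: rel_sim_zero)

text \<open>When \<open>g\<close> is onto, its converse lies in \<open>S\<close> and undoes it: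
  \<open>f\<close> is contained in \<open>(f O g) O g\<inverse>\<close>, hence similar to it, so
  this triple composite is not onto either. When \<open>g\<close> is not onto, the range of the
  composite is already too small.\<close>

lemma nonsurj_comp_right:
  assumes "Range f \<noteq> UNIV" "f \<in> S" "g \<in> S"
  shows "Range (f O g) \<noteq> UNIV"
proof (cases "Range g = UNIV")
  case True
  then have ginv: "g\<inverse> \<in> S" using assms converse_closed by blast
  have "f \<subseteq> (f O g) O g\<inverse>"
    using total[OF assms(3)] by (meson converseI relcomp.relcompI subrelI)
  then have "rel_sim ((f O g) O g\<inverse>) f"
    using assms ginv by (meson rel_sim_sym sim_subset comp_closed)
  then have *: "Range ((f O g) O g\<inverse>) \<noteq> UNIV"
    using assms ginv by (meson nonsurj_sim comp_closed)
  show ?thesis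
  proof
    assume fg: "Range (f O g) = UNIV"
    \<comment> \<open>Any \<open>y\<close> is reached by going to a value of \<open>g\<close> at
      \<open>y\<close>, which \<open>f O g\<close> attains, and back along the converse.\<close>
    have "y \<in> Range ((f O g) O g\<inverse>)" for y
    proof -
      obtain z where "(y, z) \<in> g" using total assms by blast
      moreover obtain x where "(x, z) \<in> f O g" using fg by blast
      ultimately show ?thesis by blast
    qed
    then show False using * by blast
  qed
qed blast

lemma nonsurj_comp_left: "Range g \<noteq> UNIV \<Longrightarrow> Range (f O g) \<noteq> UNIV"
  by blast

text \<open>Composition reads left to right, so \<open>h\<close> is applied last, and its additivity
  and totality give an equality.\<close>

lemma comp_plus_left:
  assumes "h \<in> S"
  shows "rel_plus f g O h = rel_plus (f O h) (g O h)"
proof (rule rel_eqI, rule iffI)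
  fix x z assume "(x, z) \<in> rel_plus f g O h"
  then obtain y w where yz: "(y, z) \<in> h" and w: "(x, w) \<in> f" "(x, y - w) \<in> g" by auto
  obtain v where v: "(w, v) \<in> h" using total assms by blast
  then have "(y - w, z - v) \<in> h" using yz assms diff by blast
  then have "(x, v + (z - v)) \<in> rel_plus (f O h) (g O h)"
    using w v by (intro rel_plusI) blast+
  then show "(x, z) \<in> rel_plus (f O h) (g O h)" by simp
next
  fix x z assume "(x, z) \<in> rel_plus (f O h) (g O h)"
  then obtain v y y' where *: "(x, y) \<in> f" "(y, v) \<in> h" "(x, y') \<in> g" "(y', z - v) \<in> h" by auto
  have "(x, y + y') \<in> rel_plus f g" using * by (intro rel_plusI)
  moreover have "(y + y', v + (z - v)) \<in> h" using * assms by (intro add_pair)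
  ultimately have "(x, v + (z - v)) \<in> rel_plus f g O h" by (rule relcomp.relcompI)
  then show "(x, z) \<in> rel_plus f g O h" by simp
qed

text \<open>Only an inclusion: \<open>f\<close> may be multivalued, and on the right the two
  summands may pass through different values of \<open>f\<close> at the same point.\<close>

lemma comp_plus_right: "f O rel_plus g h \<subseteq> rel_plus (f O g) (f O h)"
proof clarify
  fix x y z assume "(x, y) \<in> f" "(y, z) \<in> rel_plus g h"
  then obtain w where "(x, w) \<in> f O g" "(x, z - w) \<in> f O h" by auto
  then have "(x, w + (z - w)) \<in> rel_plus (f O g) (f O h)" by (rule rel_plusI)
  then show "(x, z) \<in> rel_plus (f O g) (f O h)" by simp
qed

lemma comp_neg_right: "f O rel_neg g = rel_neg (f O g)"
  by (rule rel_eqI) (simp add: relcomp_unfold)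

lemma comp_neg_left: "g \<in> S \<Longrightarrow> rel_neg f O g = rel_neg (f O g)"
  
  by (intro rel_eqI) (simp add: relcomp_unfold, metis minus_minus neg_pair)

text \<open>The difference of the composites equals (f - f') followed by \<open>g\<close>, which
  cannot be onto by \<open>nonsurj_comp_right\<close>.\<close>

lemma sim_comp_left:
  assumes "rel_sim f f'" "f \<in> S" "f' \<in> S" "g \<in> S"
  shows "rel_sim (f O g) (f' O g)"
proof -
  have "Range (rel_plus f (rel_neg f') O g) \<noteq> UNIV"
    using assms by (intro nonsurj_comp_right[of "rel_plus f (rel_neg f')"])
      (simp_all add: rel_sim_def plus_closed neg_closed)
  then show ?thesis
    using assms by (simp add: rel_sim_def comp_plus_left comp_neg_left)
qed

text \<open>Distributivity on this side is only an inclusion, so \<open>f\<close> followed by g - g'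
  is similar rather than equal to the difference of the composites. Its range lies in that of g -
  g'.\<close>

lemma sim_comp_right:
  assumes "rel_sim g g'" "f \<in> S" "g \<in> S" "g' \<in> S"
  shows "rel_sim (f O g) (f O g')"
proof -
  let ?d = "rel_plus g (rel_neg g')" and ?e = "rel_plus (f O g) (rel_neg (f O g'))"
  have S: "f O ?d \<in> S" "?e \<in> S"
    using assms by (auto intro: plus_closed neg_closed comp_closed)
  have "f O ?d \<subseteq> ?e"
    using comp_plus_right[of f g "rel_neg g'"] by (simp add: comp_neg_right)
  then have "rel_sim ?e (f O ?d)"
    using S by (meson rel_sim_sym sim_subset)
  moreover have "Range (f O ?d) \<noteq> UNIV"
    using assms unfolding rel_sim_def by (rule_tac nonsurj_comp_left)
  ultimately show ?thesis
    using S nonsurj_sim unfolding rel_sim_def[of "f O g"] by blast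
qed

lemma sim_comp:
  assumes "rel_sim f f'" "rel_sim g g'" "f \<in> S" "f' \<in> S" "g \<in> S" "g' \<in> S"
  shows "rel_sim (f O g) (f' O g')"
  using sim_trans[OF sim_comp_left[OF assms(1)] sim_comp_right[OF assms(2)]] assms comp_closed
  by blast

end

section \<open>The quotient division ring\<close>

text \<open>\<open>cls\<close> is left abstract: any function that separates exactly the similarity
  classes of \<open>S\<close> will do, so the type carrying the quotient can be chosen
  later.\<close>

locale division_relations_quotient = division_relations S
  for S :: "('m::ab_group_add \<times> 'm) set set" +
  fixes cls :: "('m \<times> 'm) set \<Rightarrow> 'b"
  assumes cls_eq: "f \<in> S \<Longrightarrow> g \<in> S \<Longrightarrow> cls f = cls g \<longleftrightarrow> rel_sim f g"
begin

definition rep :: "'b \<Rightarrow> ('m \<times> 'm) set" where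
  "rep = inv_into S cls"

definition quot :: "'b ring" where
  "quot = \<lparr>carrier = cls ` S, mult = (\<lambda>X Y. cls (rep X O rep Y)), one = cls Id,
     zero = cls rel_zero, add = (\<lambda>X Y. cls (rel_plus (rep X) (rep Y)))\<rparr>"

lemma rep_cls: "f \<in> S \<Longrightarrow> rep (cls f) \<in> S" "f \<in> S \<Longrightarrow> rel_sim (rep (cls f)) f"
proof -
  assume f: "f \<in> S"
  then have "cls f \<in> cls ` S" by blast
  then show "rep (cls f) \<in> S" unfolding rep_def by (rule inv_into_into)
  then show "rel_sim (rep (cls f)) f"
    using f cls_eq[OF _ f, of "rep (cls f)"] \<open>cls f \<in> cls ` S\<close>
    by (simp add: rep_def f_inv_into_f)
qed

lemma carrier_quot: "carrier quot = cls ` S"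
  by (simp add: quot_def)

lemma mult_cls: "f \<in> S \<Longrightarrow> g \<in> S \<Longrightarrow> cls f \<otimes>\<^bsub>quot\<^esub> cls g = cls (f O g)"
  by (simp add: quot_def cls_eq comp_closed rep_cls sim_comp)

lemma add_cls: "f \<in> S \<Longrightarrow> g \<in> S \<Longrightarrow> cls f \<oplus>\<^bsub>quot\<^esub> cls g = cls (rel_plus f g)"
  by (simp add: quot_def cls_eq plus_closed rep_cls sim_plus)

lemma one_quot: "\<one>\<^bsub>quot\<^esub> = cls Id" and zero_quot: "\<zero>\<^bsub>quot\<^esub> = cls rel_zero"
  by (simp_all add: quot_def)

lemma add_neg_cls: "f \<in> S \<Longrightarrow> cls (rel_neg f) \<oplus>\<^bsub>quot\<^esub> cls f = \<zero>\<^bsub>quot\<^esub>"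
  using sim_refl[of f]
  by (simp add: add_cls neg_closed zero_quot cls_eq plus_closed zero_closed rel_sim_zero
      rel_sim_def[of f] rel_plus_commute[of "rel_neg f" f])

lemma ring_quot: "ring quot"
proof (rule ringI)
  show "abelian_group quot"
  proof (rule abelian_groupI)
    fix x assume "x \<in> carrier quot"
    then show "\<exists>y \<in> carrier quot. y \<oplus>\<^bsub>quot\<^esub> x = \<zero>\<^bsub>quot\<^esub>"
      using add_neg_cls neg_closed by (auto simp: carrier_quot)
  next
    fix x y assume "x \<in> carrier quot" "y \<in> carrier quot"
    then show "x \<oplus>\<^bsub>quot\<^esub> y = y \<oplus>\<^bsub>quot\<^esub> x"
      by (auto simp: carrier_quot add_cls rel_plus_commute)
  qed (auto simp: carrier_quot add_cls plus_closed rel_plus_assoc zero_quot zero_closed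
      rel_plus_zero)
  show "monoid quot"
    by (rule monoidI) (auto simp: carrier_quot mult_cls comp_closed one_quot Id_closed O_assoc)
next
  fix x y z assume "x \<in> carrier quot" "y \<in> carrier quot" "z \<in> carrier quot"
  then obtain f g h where [simp]: "f \<in> S" "g \<in> S" "h \<in> S" "x = cls f" "y = cls g" "z = cls h"
    by (auto simp: carrier_quot)
  show "(x \<oplus>\<^bsub>quot\<^esub> y) \<otimes>\<^bsub>quot\<^esub> z = x \<otimes>\<^bsub>quot\<^esub> z \<oplus>\<^bsub>quot\<^esub> y \<otimes>\<^bsub>quot\<^esub> z"
    by (simp add: add_cls mult_cls plus_closed comp_closed comp_plus_left)
  \<comment> \<open>The two sides are represented by relations of which one contains the other, and
    \<open>sim_subset\<close> identifies their classes.\<close>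
  show "z \<otimes>\<^bsub>quot\<^esub> (x \<oplus>\<^bsub>quot\<^esub> y) = z \<otimes>\<^bsub>quot\<^esub> x \<oplus>\<^bsub>quot\<^esub> z \<otimes>\<^bsub>quot\<^esub> y"
    by (simp add: add_cls mult_cls plus_closed comp_closed cls_eq sim_subset comp_plus_right)
qed

lemma skew_field_quot: "skew_field quot"
proof -
  have one_zero: "\<one>\<^bsub>quot\<^esub> \<noteq> \<zero>\<^bsub>quot\<^esub>"
    unfolding one_quot zero_quot cls_eq[OF Id_closed zero_closed] rel_sim_zero by auto
  interpret ring quot by (rule ring_quot)
  show ?thesis
  proof
    show "\<one>\<^bsub>quot\<^esub> \<noteq> \<zero>\<^bsub>quot\<^esub>" by (fact one_zero)
    show "Units quot = carrier quot - {\<zero>\<^bsub>quot\<^esub>}"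
    proof (intro equalityI subsetI)
      fix x assume "x \<in> Units quot"
      then show "x \<in> carrier quot - {\<zero>\<^bsub>quot\<^esub>}"
        using one_zero by (auto simp: Units_def)
    next
      fix x assume "x \<in> carrier quot - {\<zero>\<^bsub>quot\<^esub>}"
      then obtain f where f: "f \<in> S" "x = cls f" and "cls f \<noteq> cls rel_zero"
        by (auto simp: carrier_quot zero_quot)
      then have surj: "Range f = UNIV"
        using cls_eq[OF f(1) division_relations.zero_closed[OF division_relations_axioms]]
        by (simp add: rel_sim_zero)
      have finv: "f\<inverse> \<in> S" using f surj converse_closed by blast
      \<comment> \<open>The first inclusion is totality of \<open>f\<close>, the second its
        surjectivity. Up to similarity both are equalities, so the converse represents the
        inverse.\<close>
      have "Id \<subseteq> f O f\<inverse>" "Id \<subseteq> f\<inverse> O f"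
        using total[OF f(1)] surj by blast+
      then have "rel_sim Id (f O f\<inverse>)" "rel_sim Id (f\<inverse> O f)"
        using f finv by (auto intro!: sim_subset Id_closed comp_closed)
      then have "x \<otimes>\<^bsub>quot\<^esub> cls (f\<inverse>) = \<one>\<^bsub>quot\<^esub>" "cls (f\<inverse>) \<otimes>\<^bsub>quot\<^esub> x = \<one>\<^bsub>quot\<^esub>"
        using f finv
        by (simp_all add: mult_cls one_quot cls_eq[THEN iffD2, OF _ _ rel_sim_sym] comp_closed
            Id_closed)
      then show "x \<in> Units quot"
        using f finv by (auto simp: Units_def carrier_quot)
    qed
  qed
qed

end

section \<open>Matrices acting on powers of a module\<close>

definition del_row :: "nat \<Rightarrow> 'r mat \<Rightarrow> 'r mat" where
  "del_row i A = mat (dim_row A - 1) (dim_col A) (\<lambda>(k, j). A $$ (insert_index i k, j))"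

definition row_cons :: "'r vec \<Rightarrow> 'r mat \<Rightarrow> 'r mat" where
  "row_cons u A = mat (Suc (dim_row A)) (dim_col A)
     (\<lambda>(i, j). if i = 0 then u $ j else A $$ (i - 1, j))"

lemma del_row_carrier: "A \<in> carrier_mat (Suc n) m \<Longrightarrow> del_row i A \<in> carrier_mat n m"
  by (auto simp: del_row_def)

lemma row_cons_carrier: "A \<in> carrier_mat n m \<Longrightarrow> row_cons u A \<in> carrier_mat (Suc n) m"
  by (auto simp: row_cons_def)

lemma row_row_cons: "u \<in> carrier_vec (dim_col A) \<Longrightarrow> row (row_cons u A) 0 = u"
  by (auto simp: row_cons_def)

lemma del_row_row_cons: "del_row 0 (row_cons u A) = A"
  by (auto simp: del_row_def row_cons_def insert_index_def)

lemma sum_insert_index: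
  assumes "i \<le> n"
  shows "(\<Sum>k<Suc n. f k) = f i + (\<Sum>k<n. f (insert_index i k) :: 'a::comm_monoid_add)"
proof -
  have "(\<Sum>k<Suc n. f k) = f i + (\<Sum>k\<in>{0..<Suc n} - {i}. f k)"
    using assms by (subst sum.remove[of _ i]) (auto simp: atLeast0LessThan)
  also have "{0..<Suc n} - {i} = insert_index i ` {0..<n}"
    using assms by (simp add: insert_index_image)
  finally show ?thesis
    by (simp add: sum.reindex[OF insert_index_inj_on] atLeast0LessThan)
qed

lemma append_vec_add':
  assumes "v \<in> carrier_vec n" "v' \<in> carrier_vec n" "w \<in> carrier_vec m" "w' \<in> carrier_vec m"
  shows "(v @\<^sub>v w) + (v' @\<^sub>v w') = (v + v') @\<^sub>v (w + w')"
  using append_vec_add[OF assms] by simp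

lemma map_vec_append: "map_vec f (u @\<^sub>v v) = map_vec f u @\<^sub>v map_vec f v"
  by auto

lemma carrier_vec_appendE:
  assumes "v \<in> carrier_vec (n + m)"
  obtains a b where "a \<in> carrier_vec n" "b \<in> carrier_vec m" "v = a @\<^sub>v b"
  using assms by (metis vec_first_carrier vec_first_last_append vec_last_carrier)

section \<open>Images of matrices acting on row vectors over the module\<close>

context right_module
begin

lemma act_zero_left [simp]: "act 0 r = 0"
  using act_add_left[of 0 0 r] by simp

lemma act_zero_right [simp]: "act x 0 = 0"
  using act_add_right[of x 0 0] by simp

lemma act_minus_left: "act (- x) r = - act x r"
  using act_add_left[of x "- x" r] by (simp add: eq_neg_iff_add_eq_0 add.commute)

lemma act_minus_right: "act x (- r) = - act x r"
  using act_add_right[of x r "- r"] by (simp add: eq_neg_iff_add_eq_0 add.commute)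

lemma act_diff_left: "act (x - y) r = act x r - act y r"
  using act_add_left[of x "- y" r] by (simp add: act_minus_left)

lemma act_sum_left: "act (\<Sum>i\<in>I. f i) r = (\<Sum>i\<in>I. act (f i) r)"
  by (induction I rule: infinite_finite_induct) (auto simp: act_add_left)

lemma act_sum_right: "act x (\<Sum>i\<in>I. f i) = (\<Sum>i\<in>I. act x (f i))"
  by (induction I rule: infinite_finite_induct) (auto simp: act_add_right)

abbreviation row_act :: "'m \<Rightarrow> 'r vec \<Rightarrow> 'm vec" (infixl "\<star>" 70) where
  "x \<star> u \<equiv> map_vec (act x) u"

abbreviation img :: "'r mat \<Rightarrow> 'm vec set" where
  "img \<equiv> mat_image act"

lemma row_act_uminus: "(- x) \<star> u = - (x \<star> u)"
  by (auto simp: act_minus_left)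

lemma row_act_zero: "0 \<star> u = 0\<^sub>v (dim_vec u)"
  by auto

lemma row_act_zero_vec: "x \<star> 0\<^sub>v n = 0\<^sub>v n"
  by auto

lemma row_act_add_vec: "dim_vec u = dim_vec v \<Longrightarrow> x \<star> (u + v) = x \<star> u + x \<star> v"
  by (auto simp: act_add_right)

lemma row_act_uminus_vec: "x \<star> (- u) = - (x \<star> u)"
  by (auto simp: act_minus_right)

lemma mat_act_carrier [simp]: "mat_act act A v \<in> carrier_vec (dim_col A)"
  by (simp add: mat_act_def)

lemma img_subset: "img A \<subseteq> carrier_vec (dim_col A)"
  by (auto simp: mat_image_def)

lemma imgD: "p \<in> img A \<Longrightarrow> A \<in> carrier_mat n m \<Longrightarrow> p \<in> carrier_vec m"
  using img_subset by auto

lemma img_diff: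
  assumes "p \<in> img A" "q \<in> img A"
  shows "p - q \<in> img A"
proof -
  obtain v w where "v \<in> carrier_vec (dim_row A)" "w \<in> carrier_vec (dim_row A)"
      "p = mat_act act A v" "q = mat_act act A w"
    using assms by (auto simp: mat_image_def)
  then have "p - q = mat_act act A (v - w)"
    by (auto simp: mat_act_def act_diff_left sum_subtractf)
  then show ?thesis
    using \<open>v \<in> _\<close> \<open>w \<in> _\<close> minus_carrier_vec by (auto simp: mat_image_def)
qed

lemma img_zero [simp]: "A \<in> carrier_mat n m \<Longrightarrow> 0\<^sub>v m \<in> img A"
proof -
  assume "A \<in> carrier_mat n m"
  then have "0\<^sub>v m = mat_act act A (0\<^sub>v (dim_row A))"
    by (auto simp: mat_act_def)
  then show ?thesis
    by (auto simp: mat_image_def)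
qed

lemma img_uminus: "p \<in> img A \<Longrightarrow> - p \<in> img A"
proof -
  assume p: "p \<in> img A"
  then have "0\<^sub>v (dim_col A) - p \<in> img A"
    by (intro img_diff img_zero[of A "dim_row A"]) auto
  moreover have "0\<^sub>v (dim_col A) - p = - p"
    using p img_subset[of A] by auto
  ultimately show ?thesis by simp
qed

lemma img_add: "p \<in> img A \<Longrightarrow> q \<in> img A \<Longrightarrow> p + q \<in> img A"
proof -
  assume p: "p \<in> img A" "q \<in> img A"
  then have "p - - q \<in> img A" by (intro img_diff img_uminus)
  moreover have "p - - q = p + q" using p img_subset[of A] by auto
  ultimately show ?thesis by simp
qed

lemma mat_act_del_row:
  assumes "A \<in> carrier_mat (Suc n) m" "i \<le> n" "v \<in> carrier_vec (Suc n)"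
  shows "mat_act act A v =
    v $ i \<star> row A i + mat_act act (del_row i A) (vec n (\<lambda>k. v $ insert_index i k))"
  using assms by (auto simp: mat_act_def del_row_def sum_insert_index[of i n]
      simp del: sum.lessThan_Suc intro!: sum.cong)

text \<open>Separates the coefficient of row \<open>i\<close>, which is an arbitrary module element,
  from the combination of the remaining rows.\<close>

lemma img_del_row:
  assumes A: "A \<in> carrier_mat (Suc n) m" and i: "i \<le> n"
  shows "img A = {p. \<exists>x. \<exists>q \<in> img (del_row i A). p = x \<star> row A i + q}"
proof (intro equalityI subsetI)
  fix p assume "p \<in> img A"
  then obtain v where "v \<in> carrier_vec (Suc n)" "p = mat_act act A v"
    using A by (auto simp: mat_image_def)
  then show "p \<in> {p. \<exists>x. \<exists>q \<in> img (del_row i A). p = x \<star> row A i + q}"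
    using mat_act_del_row[OF A i, of v] A by (force simp: mat_image_def del_row_def)
next
  fix p assume "p \<in> {p. \<exists>x. \<exists>q \<in> img (del_row i A). p = x \<star> row A i + q}"
  then obtain x w where p: "p = x \<star> row A i + mat_act act (del_row i A) w"
    and w: "w \<in> carrier_vec n"
    using A by (auto simp: mat_image_def del_row_def)
  \<comment> \<open>\<open>w\<close> with the coefficient \<open>x\<close> inserted at position
    \<open>i\<close>.\<close>
  define v where "v = vec (Suc n) (\<lambda>k. if k = i then x else w $ delete_index i k)"
  have "vec n (\<lambda>k. v $ insert_index i k) = w"
    using w by (auto simp: v_def insert_index_def delete_index_def)
  then have "p = mat_act act A v"
    using mat_act_del_row[OF A i, of v] i p by (simp add: v_def)
  then show "p \<in> img A"
    using A by (auto simp: mat_image_def v_def)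
qed

lemma img_row_cons:
  assumes "A \<in> carrier_mat n m" "u \<in> carrier_vec m"
  shows "img (row_cons u A) = {p. \<exists>x. \<exists>q \<in> img A. p = x \<star> u + q}"
  using assms img_del_row[OF row_cons_carrier, of A n m 0 u]
  by (simp add: row_row_cons del_row_row_cons)

lemma mat_act_dsum:
  assumes "A \<in> carrier_mat n m" "B \<in> carrier_mat n' m'" "v \<in> carrier_vec n" "w \<in> carrier_vec n'"
  shows "mat_act act (A \<oplus>\<^sub>d B) (v @\<^sub>v w) = mat_act act A v @\<^sub>v mat_act act B w"
proof (rule eq_vecI)
  fix j assume "j < dim_vec (mat_act act A v @\<^sub>v mat_act act B w)"
  then have j: "j < m + m'" using assms by (simp add: mat_act_def)
  have split: "(\<Sum>i<n + n'. f i) = (\<Sum>i<n. f i) + (\<Sum>i<n'. f (n + i))" for f :: "nat \<Rightarrow> 'm"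
    by (induction n') (auto simp: add.assoc)
  show "mat_act act (A \<oplus>\<^sub>d B) (v @\<^sub>v w) $ j = (mat_act act A v @\<^sub>v mat_act act B w) $ j"
    using assms j by (auto simp: mat_act_def mat_dsum_def split)
qed (use assms in \<open>auto simp: mat_act_def mat_dsum_def\<close>)

lemma mat_dsum_carrier:
  "A \<in> carrier_mat n m \<Longrightarrow> B \<in> carrier_mat n' m' \<Longrightarrow> A \<oplus>\<^sub>d B \<in> carrier_mat (n + n') (m + m')"
  by (auto simp: mat_dsum_def)

lemma img_dsum:
  assumes "A \<in> carrier_mat n m" "B \<in> carrier_mat n' m'"
  shows "img (A \<oplus>\<^sub>d B) = {p @\<^sub>v q | p q. p \<in> img A \<and> q \<in> img B}"
proof (intro equalityI subsetI)
  fix p assume "p \<in> img (A \<oplus>\<^sub>d B)"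
  then obtain v where "v \<in> carrier_vec (n + n')" "p = mat_act act (A \<oplus>\<^sub>d B) v"
    using assms by (auto simp: mat_image_def mat_dsum_def)
  then show "p \<in> {p @\<^sub>v q | p q. p \<in> img A \<and> q \<in> img B}"
    using assms mat_act_dsum[OF assms] by (auto simp: mat_image_def elim!: carrier_vec_appendE)
next
  fix p assume "p \<in> {p @\<^sub>v q | p q. p \<in> img A \<and> q \<in> img B}"
  then obtain v w where "v \<in> carrier_vec n" "w \<in> carrier_vec n'"
      "p = mat_act act A v @\<^sub>v mat_act act B w"
    using assms by (auto simp: mat_image_def)
  then show "p \<in> img (A \<oplus>\<^sub>d B)"
    using assms mat_act_dsum[OF assms, of v w] mat_dsum_carrier[OF assms]
    by (auto simp: mat_image_def intro!: image_eqI[of _ _ "v @\<^sub>v w"])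
qed

lemma append_in_img_dsum:
  assumes "A \<in> carrier_mat n m" "B \<in> carrier_mat n' m'" "p \<in> carrier_vec m"
  shows "p @\<^sub>v q \<in> img (A \<oplus>\<^sub>d B) \<longleftrightarrow> p \<in> img A \<and> q \<in> img B"
proof
  assume "p @\<^sub>v q \<in> img (A \<oplus>\<^sub>d B)"
  then obtain p' q' where "p' \<in> img A" "q' \<in> img B" "p @\<^sub>v q = p' @\<^sub>v q'"
    by (auto simp: img_dsum[OF assms(1,2)])
  then show "p \<in> img A \<and> q \<in> img B"
    using append_vec_eq[OF assms(3) imgD[OF _ assms(1)]] by auto
qed (auto simp: img_dsum[OF assms(1,2)])

lemma mat_surj_iff: "A \<in> carrier_mat n m \<Longrightarrow> mat_surj act A \<longleftrightarrow> (\<forall>p \<in> carrier_vec m. p \<in> img A)"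
  using img_subset[of A] by (auto simp: mat_surj_def)

lemma mat_surj_dsum:
  assumes "A \<in> carrier_mat n m" "B \<in> carrier_mat n' m'"
  shows "mat_surj act (A \<oplus>\<^sub>d B) \<longleftrightarrow> mat_surj act A \<and> mat_surj act B"
proof -
  have "(\<forall>p \<in> carrier_vec (m + m'). p \<in> img (A \<oplus>\<^sub>d B)) \<longleftrightarrow>
      (\<forall>p \<in> carrier_vec m. \<forall>q \<in> carrier_vec m'. p @\<^sub>v q \<in> img (A \<oplus>\<^sub>d B))"
    by (auto elim!: carrier_vec_appendE)
  also have "\<dots> \<longleftrightarrow> (\<forall>p \<in> carrier_vec m. p \<in> img A) \<and> (\<forall>q \<in> carrier_vec m'. q \<in> img B)"
    using append_in_img_dsum[OF assms] zero_carrier_vec by blast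
  finally show ?thesis
    using assms mat_dsum_carrier[OF assms] by (simp add: mat_surj_iff)
qed

text \<open>Vectors are rows, so the left factor of a product acts first.\<close>

lemma mat_act_mult:
  assumes "A \<in> carrier_mat n k" "B \<in> carrier_mat k m" "v \<in> carrier_vec n"
  shows "mat_act act (A * B) v = mat_act act B (mat_act act A v)"
proof (rule eq_vecI)
  fix j assume "j < dim_vec (mat_act act B (mat_act act A v))"
  then have j: "j < m" using assms by (simp add: mat_act_def)
  have "mat_act act (A * B) v $ j = (\<Sum>i<n. \<Sum>l<k. act (act (v $ i) (A $$ (i, l))) (B $$ (l, j)))"
    using assms j by (simp add: mat_act_def scalar_prod_def act_sum_right act_mult atLeast0LessThan)
  also have "\<dots> = (\<Sum>l<k. \<Sum>i<n. act (act (v $ i) (A $$ (i, l))) (B $$ (l, j)))"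
    by (rule sum.swap)
  also have "\<dots> = mat_act act B (mat_act act A v) $ j"
    using assms j by (simp add: mat_act_def act_sum_left)
  finally show "mat_act act (A * B) v $ j = mat_act act B (mat_act act A v) $ j" .
qed (use assms in \<open>auto simp: mat_act_def\<close>)

text \<open>The image of \<open>A * B\<close> is the image of \<open>A\<close> carried on by
  \<open>B\<close>, so surjectivity of the product forces that of the last factor.\<close>

lemma mat_surj_mult:
  assumes "A \<in> carrier_mat n k" "B \<in> carrier_mat k m"
  shows "mat_surj act (A * B) \<Longrightarrow> mat_surj act B"
    and "mat_surj act A \<Longrightarrow> mat_surj act B \<Longrightarrow> mat_surj act (A * B)"
proof -
  have "img (A * B) = mat_act act B ` img A"
    using assms by (auto simp: mat_image_def mat_act_mult image_iff)
  moreover have "img A \<subseteq> carrier_vec k" "img B = mat_act act B ` carrier_vec k"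
      "A * B \<in> carrier_mat n m"
    using assms img_subset[of A] by (auto simp: mat_image_def)
  ultimately show "mat_surj act (A * B) \<Longrightarrow> mat_surj act B"
      "mat_surj act A \<Longrightarrow> mat_surj act B \<Longrightarrow> mat_surj act (A * B)"
    using assms img_subset[of B] image_mono[of "img A" "carrier_vec k" "mat_act act B"]
    unfolding mat_surj_def by auto
qed

lemma mat_act_one: "v \<in> carrier_vec n \<Longrightarrow> mat_act act (1\<^sub>m n) v = v"
proof (rule eq_vecI)
  fix j assume v: "v \<in> carrier_vec n" and "j < dim_vec v"
  then have j: "j < n" by simp
  have "mat_act act (1\<^sub>m n) v $ j = (\<Sum>i<n. if i = j then v $ j else 0)"
    using j by (auto simp: mat_act_def act_one simp del: sum.delta intro!: sum.cong)
  then show "mat_act act (1\<^sub>m n) v $ j = v $ j" using j by simp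
qed (simp add: mat_act_def)

lemma mat_surj_one: "mat_surj act (1\<^sub>m n)"
proof -
  have "p \<in> img (1\<^sub>m n)" if "p \<in> carrier_vec n" for p
    using that mat_act_one[OF that] by (force simp: mat_image_def)
  then show ?thesis by (simp add: mat_surj_iff[OF one_carrier_mat])
qed

lemma mat_surj_invertible:
  "U \<in> carrier_mat n n \<Longrightarrow> V \<in> carrier_mat n n \<Longrightarrow> U * V = 1\<^sub>m n \<Longrightarrow> mat_surj act V"
  using mat_surj_mult(1)[of U n n V n] mat_surj_one by simp

end

section \<open>Relations defined by matrices\<close>

context right_module
begin

text \<open>
  For \<open>A\<close> with \<open>n - 1\<close> rows, \<open>full u A\<close> says that \<open>A\<close> with the row \<open>u\<close> adjoined is a square matrix
  acting surjectively.
\<close>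

definition full :: "'r vec \<Rightarrow> 'r mat \<Rightarrow> bool" where
  "full u A \<longleftrightarrow> (\<forall>p \<in> carrier_vec (dim_col A). \<exists>x. p + x \<star> u \<in> img A)"

lemma mem_img_cancel:
  assumes "p + q \<in> img A" "q \<in> img A" "p \<in> carrier_vec m" "A \<in> carrier_mat n m"
  shows "p \<in> img A"
proof -
  have "p + q - q \<in> img A" using assms by (intro img_diff)
  moreover have "p + q - q = p" using assms(3) imgD[OF assms(2,4)] by auto
  ultimately show ?thesis by simp
qed

text \<open>Negating the coefficient moves the multiple of \<open>v\<close> to the side of
  \<open>p\<close>. This is the form in which adjoined rows enter \<open>full\<close> and
  \<open>lin_rel\<close>.\<close>

lemma mem_img_row_cons:
  assumes A: "A \<in> carrier_mat n m" and v: "v \<in> carrier_vec m" and p: "p \<in> carrier_vec m"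
  shows "p \<in> img (row_cons v A) \<longleftrightarrow> (\<exists>x. p + x \<star> v \<in> img A)"
proof
  assume "p \<in> img (row_cons v A)"
  then obtain x q where q: "q \<in> img A" "p = x \<star> v + q"
    using img_row_cons[OF A v] by auto
  then have "p + (- x) \<star> v = q"
    using imgD[OF q(1) A] v by (auto simp: act_minus_left)
  then show "\<exists>x. p + x \<star> v \<in> img A" using q by metis
next
  assume "\<exists>x. p + x \<star> v \<in> img A"
  then obtain x where "p + x \<star> v \<in> img A" by blast
  moreover have "p = (- x) \<star> v + (p + x \<star> v)"
    using p v by (auto simp: act_minus_left)
  ultimately show "p \<in> img (row_cons v A)"
    using img_row_cons[OF A v] by blast
qed

lemma mat_surj_row:
  assumes A: "A \<in> carrier_mat (Suc n) m" and i: "i \<le> n"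
  shows "mat_surj act A \<longleftrightarrow> full (row A i) (del_row i A)"
proof -
  note D = del_row_carrier[OF A, of i]
  have row: "row A i \<in> carrier_vec m" using A by auto
  have "img A = img (row_cons (row A i) (del_row i A))"
    by (simp add: img_del_row[OF A i] img_row_cons[OF D row])
  then show ?thesis
    using mem_img_row_cons[OF D row] D by (auto simp: mat_surj_iff[OF A] full_def)
qed

lemma full_row_cons:
  assumes "A \<in> carrier_mat n m" "u \<in> carrier_vec m" "v \<in> carrier_vec m"
  shows "full u (row_cons v A) \<longleftrightarrow> (\<forall>p \<in> carrier_vec m. \<exists>x y. p + x \<star> u + y \<star> v \<in> img A)"
proof -
  have "p + x \<star> u \<in> img (row_cons v A) \<longleftrightarrow> (\<exists>y. p + x \<star> u + y \<star> v \<in> img A)"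
    if "p \<in> carrier_vec m" for p x
    using assms that by (intro mem_img_row_cons) auto
  then show ?thesis
    using row_cons_carrier[OF assms(1), of v] by (auto simp: full_def)
qed

text \<open>Surjectivity does not depend on the order of the two adjoined rows, so either of them
  can be the one that \<open>full_add\<close> splits.\<close>

lemma full_swap:
  assumes "A \<in> carrier_mat n m" "u \<in> carrier_vec m" "v \<in> carrier_vec m"
  shows "full u (row_cons v A) \<longleftrightarrow> full v (row_cons u A)"
proof -
  have "p + x \<star> u + y \<star> v = p + y \<star> v + x \<star> u" if "p \<in> carrier_vec m" for p x y
    using assms that by (auto simp: ac_simps)
  then show ?thesis
    unfolding full_row_cons[OF assms] full_row_cons[OF assms(1,3,2)] by (metis (no_types, lifting))
qed

lemma full_uminus: "full (- u) A \<longleftrightarrow> full u A"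
  unfolding full_def row_act_uminus_vec by (metis minus_minus row_act_uminus)

lemma spans_with_iff:
  assumes A: "A \<in> carrier_mat n m" and u: "u \<in> carrier_vec m"
  shows "spans_with m (row_image act u) (img A) \<longleftrightarrow> full u A"
proof -
  let ?G = "monoid_vec TYPE('m) m"
  interpret comm_group ?G by (rule comm_group_vec)
  \<comment> \<open>The sum of the subgroups \<open>row_image act u\<close> and
    \<open>img A\<close>, described by cancelling a multiple of \<open>u\<close>; it is the subgroup
    that they generate.\<close>
  define H where "H = {p \<in> carrier_vec m. \<exists>x. p + x \<star> u \<in> img A}"
  have sub: "row_image act u \<union> img A \<subseteq> carrier ?G"
    using u imgD[OF _ A] by (auto simp: row_image_def monoid_vec_simps)
  have inv: "inv\<^bsub>?G\<^esub> p = - p" if "p \<in> carrier_vec m" for p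
    using that by (intro inv_equality) (auto simp: monoid_vec_simps)
  have "subgroup H ?G"
  proof (rule subgroupI)
    show "H \<subseteq> carrier ?G" by (auto simp: H_def monoid_vec_simps)
    have "0\<^sub>v m + 0 \<star> u \<in> img A" using u A by (simp add: row_act_zero)
    then have "0\<^sub>v m \<in> H" unfolding H_def mem_Collect_eq by (intro conjI exI[of _ 0]) auto
    then show "H \<noteq> {}" by auto
  next
    fix p assume "p \<in> H"
    then obtain x where p: "p \<in> carrier_vec m" and x: "p + x \<star> u \<in> img A" by (auto simp: H_def)
    have "- (p + x \<star> u) = - p + (- x) \<star> u" using p u by (auto simp: act_minus_left)
    then have "- p + (- x) \<star> u \<in> img A" using img_uminus[OF x] by simp
    then show "inv\<^bsub>?G\<^esub> p \<in> H" using p unfolding H_def inv[OF p] by auto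
  next
    fix p q assume "p \<in> H" "q \<in> H"
    then obtain x y where p: "p \<in> carrier_vec m" "p + x \<star> u \<in> img A"
      and q: "q \<in> carrier_vec m" "q + y \<star> u \<in> img A" by (auto simp: H_def)
    have "(p + x \<star> u) + (q + y \<star> u) = (p + q) + (x + y) \<star> u"
      using p q u by (auto simp: act_add_left ac_simps)
    then have "(p + q) + (x + y) \<star> u \<in> img A" using img_add[OF p(2) q(2)] by simp
    then show "p \<otimes>\<^bsub>?G\<^esub> q \<in> H" using p q by (auto simp: H_def monoid_vec_simps)
  qed
  moreover have "row_image act u \<union> img A \<subseteq> H"
  proof
    fix p assume "p \<in> row_image act u \<union> img A"
    then consider x where "p = x \<star> u" | "p \<in> img A" by (auto simp: row_image_def)
    then show "p \<in> H"
    proof cases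
      case 1
      then have "p + (- x) \<star> u = 0\<^sub>v m" using u by (auto simp: act_minus_left)
      then have "p + (- x) \<star> u \<in> img A" using A by simp
      then show ?thesis using 1 u unfolding H_def by auto
    next
      case 2
      then have "p + 0 \<star> u \<in> img A" using u imgD[OF 2 A] by (simp add: row_act_zero)
      then show ?thesis using imgD[OF 2 A] unfolding H_def by blast
    qed
  qed
  ultimately have "generate ?G (row_image act u \<union> img A) \<subseteq> H"
    by (rule generate_subgroup_incl[rotated])
  moreover have "H \<subseteq> generate ?G (row_image act u \<union> img A)"
  proof
    fix p assume "p \<in> H"
    then obtain x where p: "p \<in> carrier_vec m" "p + x \<star> u \<in> img A" by (auto simp: H_def)
    have "(- x) \<star> u \<in> row_image act u" by (auto simp: row_image_def)
    then have "(- x) \<star> u \<otimes>\<^bsub>?G\<^esub> (p + x \<star> u) \<in> generate ?G (row_image act u \<union> img A)"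
      using p by (intro generate.eng generate.incl) auto
    moreover have "(- x) \<star> u \<otimes>\<^bsub>?G\<^esub> (p + x \<star> u) = p"
      using p u by (auto simp: monoid_vec_simps act_minus_left)
    ultimately show "p \<in> generate ?G (row_image act u \<union> img A)" by simp
  qed
  ultimately have "generate ?G (row_image act u \<union> img A) = H" by blast
  then show ?thesis
    using A by (auto simp: spans_with_def H_def full_def)
qed

text \<open>
  If neither \<open>u\<close> nor \<open>v\<close> is full, then either alternative of (B') forces \<open>u + v\<close> to act into the
  image of \<open>A\<close>: under (a) because both summands do, under (b) because a full row could not act
  outside it. A full row acting into the image makes that image everything.
\<close>

lemma full_add:
  assumes B': "cond_B' act" and A: "A \<in> carrier_mat k (Suc k)"
    and u: "u \<in> carrier_vec (Suc k)" and v: "v \<in> carrier_vec (Suc k)" and uv: "full (u + v) A"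
  shows "full u A \<or> full v A"
proof (rule ccontr)
  assume neg: "\<not> (full u A \<or> full v A)"
  let ?in = "\<lambda>u. row_image act u \<subseteq> img A"
  have uv_c: "u + v \<in> carrier_vec (Suc k)" using u v by simp
  have "(\<forall>w \<in> carrier_vec (Suc k). \<not> ?in w \<longrightarrow> full w A) \<or>
      (\<forall>w \<in> carrier_vec (Suc k). \<not> ?in w \<longrightarrow> \<not> full w A)"
    using B'[unfolded cond_B'_def, rule_format, of "Suc k" A] A spans_with_iff[OF A]
    by (auto simp: Let_def)
  moreover have "?in u \<Longrightarrow> ?in v \<Longrightarrow> ?in (u + v)"
    using u v by (auto simp: row_image_def row_act_add_vec intro!: img_add)
  ultimately have "?in (u + v)"
    using neg u v uv uv_c by blast
  then have "p \<in> img A" if "p \<in> carrier_vec (Suc k)" for p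
    using that uv A mem_img_cancel[OF _ _ that A]
    by (fastforce simp: full_def row_image_def)
  then have "p + 0 \<star> u \<in> img A" if "p \<in> carrier_vec (Suc k)" for p
    using that u by (simp add: row_act_zero)
  then show False using neg A by (auto simp: full_def)
qed

section \<open>Linear relations and their block constructions\<close>

text \<open>For full \<open>w\<close> every \<open>x\<close> has a value \<open>y\<close>, unique up
  to those \<open>y\<close> with \<open>y \<star> w\<close> in \<open>img A\<close>. Keeping both
  vectors on one side makes the converse a mere exchange of \<open>u\<close> and
  \<open>w\<close>.\<close>

definition lin_rel :: "'r vec \<Rightarrow> 'r vec \<Rightarrow> 'r mat \<Rightarrow> ('m \<times> 'm) set" where
  "lin_rel u w A = {(x, y). x \<star> u + y \<star> w \<in> img A}"

lemma lin_rel_iff [simp]: "(x, y) \<in> lin_rel u w A \<longleftrightarrow> x \<star> u + y \<star> w \<in> img A"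
  by (simp add: lin_rel_def)

definition lin_rels :: "('m \<times> 'm) set set" where
  "lin_rels = {lin_rel u w A | k u w A. u \<in> carrier_vec (Suc k) \<and> w \<in> carrier_vec (Suc k) \<and>
     A \<in> carrier_mat k (Suc k) \<and> full w A}"

lemma lin_relsI:
  "A \<in> carrier_mat k (Suc k) \<Longrightarrow> u \<in> carrier_vec (Suc k) \<Longrightarrow> w \<in> carrier_vec (Suc k) \<Longrightarrow>
    full w A \<Longrightarrow> lin_rel u w A \<in> lin_rels"
  by (auto simp: lin_rels_def)

lemma lin_relsE:
  assumes "f \<in> lin_rels"
  obtains k u w A where "A \<in> carrier_mat k (Suc k)" "u \<in> carrier_vec (Suc k)"
    "w \<in> carrier_vec (Suc k)" "full w A" "f = lin_rel u w A"
  using assms by (auto simp: lin_rels_def)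

lemma lin_rel_diff:
  assumes "A \<in> carrier_mat n m" "u \<in> carrier_vec m" "w \<in> carrier_vec m"
    and "(x, y) \<in> lin_rel u w A" "(x', y') \<in> lin_rel u w A"
  shows "(x - x', y - y') \<in> lin_rel u w A"
proof -
  have "(x \<star> u + y \<star> w) - (x' \<star> u + y' \<star> w) \<in> img A"
    using assms by (intro img_diff) auto
  moreover have "(x \<star> u + y \<star> w) - (x' \<star> u + y' \<star> w) = (x - x') \<star> u + (y - y') \<star> w"
    using assms by (auto simp: act_diff_left)
  ultimately show ?thesis by simp
qed

text \<open>Being onto is solvability in \<open>x\<close> for the multiples of \<open>w\<close>, and
  fullness of \<open>w\<close> reduces every vector to such a multiple modulo
  \<open>img A\<close>.\<close>

lemma Range_lin_rel:
  assumes A: "A \<in> carrier_mat n m" and u: "u \<in> carrier_vec m" and w: "w \<in> carrier_vec m"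
    and full: "full w A"
  shows "Range (lin_rel u w A) = UNIV \<longleftrightarrow> full u A"
proof
  assume surj: "Range (lin_rel u w A) = UNIV"
  show "full u A"
    unfolding full_def
  proof
    fix p :: "'m vec" assume "p \<in> carrier_vec (dim_col A)"
    then have p: "p \<in> carrier_vec m" using A by simp
    obtain y where y: "p + y \<star> w \<in> img A" using full p A by (auto simp: full_def)
    obtain x where x: "x \<star> u + y \<star> w \<in> img A"
      using surj by (metis Range_iff UNIV_I lin_rel_iff)
    have "(p + y \<star> w) - (x \<star> u + y \<star> w) = p + (- x) \<star> u"
      using p u w by (auto simp: act_minus_left)
    then show "\<exists>x. p + x \<star> u \<in> img A" using img_diff[OF y x] by metis
  qed
next
  assume "full u A"
  then have "\<exists>x. y \<star> w + x \<star> u \<in> img A" for y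
    using w A by (auto simp: full_def)
  moreover have "y \<star> w + x \<star> u = x \<star> u + y \<star> w" for x y
    using w u by (intro comm_add_vec) auto
  ultimately show "Range (lin_rel u w A) = UNIV" by (auto simp: set_eq_iff Range_iff)
qed

lemma block_in_img:
  assumes "A \<in> carrier_mat n m" "B \<in> carrier_mat n' m'" "p \<in> carrier_vec m" "q \<in> carrier_vec m'"
    and "u \<in> carrier_vec m" "u' \<in> carrier_vec m'" "v \<in> carrier_vec m" "v' \<in> carrier_vec m'"
  shows "(p @\<^sub>v q) + x \<star> (u @\<^sub>v u') + y \<star> (v @\<^sub>v v') \<in> img (A \<oplus>\<^sub>d B) \<longleftrightarrow>
    p + x \<star> u + y \<star> v \<in> img A \<and> q + x \<star> u' + y \<star> v' \<in> img B"
proof -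
  have "(p @\<^sub>v q) + x \<star> (u @\<^sub>v u') + y \<star> (v @\<^sub>v v') =
      (p + x \<star> u + y \<star> v) @\<^sub>v (q + x \<star> u' + y \<star> v')"
    using assms by (simp add: map_vec_append append_vec_add'[of _ m _ _ m'])
  then show ?thesis
    using assms by (simp add: append_in_img_dsum[OF assms(1,2)])
qed

lemma full_block:
  assumes "A \<in> carrier_mat n m" "B \<in> carrier_mat n' m'"
    and "u \<in> carrier_vec m" "u' \<in> carrier_vec m'" "v \<in> carrier_vec m" "v' \<in> carrier_vec m'"
  shows "full (u @\<^sub>v u') (row_cons (v @\<^sub>v v') (A \<oplus>\<^sub>d B)) \<longleftrightarrow>
    (\<forall>p \<in> carrier_vec m. \<forall>q \<in> carrier_vec m'. \<exists>x y.
      p + x \<star> u + y \<star> v \<in> img A \<and> q + x \<star> u' + y \<star> v' \<in> img B)"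
proof -
  have "full (u @\<^sub>v u') (row_cons (v @\<^sub>v v') (A \<oplus>\<^sub>d B)) \<longleftrightarrow>
    (\<forall>p \<in> carrier_vec (m + m'). \<exists>x y. p + x \<star> (u @\<^sub>v u') + y \<star> (v @\<^sub>v v') \<in> img (A \<oplus>\<^sub>d B))"
    using assms by (intro full_row_cons[OF mat_dsum_carrier[OF assms(1,2)]]) auto
  also have "\<dots> \<longleftrightarrow> (\<forall>p \<in> carrier_vec m. \<forall>q \<in> carrier_vec m'. \<exists>x y.
      (p @\<^sub>v q) + x \<star> (u @\<^sub>v u') + y \<star> (v @\<^sub>v v') \<in> img (A \<oplus>\<^sub>d B))"
    by (auto elim!: carrier_vec_appendE)
  finally show ?thesis
    using block_in_img[OF assms(1,2) _ _ assms(3-6)] by auto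
qed

lemma lin_rel_block:
  assumes "A \<in> carrier_mat n m" "B \<in> carrier_mat n' m'"
    and "u \<in> carrier_vec m" "u' \<in> carrier_vec m'" "v \<in> carrier_vec m" "v' \<in> carrier_vec m'"
    and "w \<in> carrier_vec m" "w' \<in> carrier_vec m'"
  shows "(x, y) \<in> lin_rel (u @\<^sub>v u') (w @\<^sub>v w') (row_cons (v @\<^sub>v v') (A \<oplus>\<^sub>d B)) \<longleftrightarrow>
    (\<exists>z. x \<star> u + y \<star> w + z \<star> v \<in> img A \<and> x \<star> u' + y \<star> w' + z \<star> v' \<in> img B)"
proof -
  have "(x, y) \<in> lin_rel (u @\<^sub>v u') (w @\<^sub>v w') (row_cons (v @\<^sub>v v') (A \<oplus>\<^sub>d B)) \<longleftrightarrow>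
    (\<exists>z. x \<star> (u @\<^sub>v u') + y \<star> (w @\<^sub>v w') + z \<star> (v @\<^sub>v v') \<in> img (A \<oplus>\<^sub>d B))"
    unfolding lin_rel_iff using assms
    by (intro mem_img_row_cons[OF mat_dsum_carrier[OF assms(1,2)]]) auto
  then show ?thesis
    using block_in_img[OF assms(1,2) _ _ assms(7,8,5,6), of "x \<star> u" "x \<star> u'"] assms
    by (simp add: map_vec_append)
qed

text \<open>The coefficient \<open>z\<close> of the extra row is the first summand: the first block
  says that \<open>z\<close> is a value of the first relation at \<open>x\<close>, the second that
  \<open>y - z\<close> is a value of the second one.\<close>

lemma lin_rel_plus:
  assumes "A \<in> carrier_mat n m" "B \<in> carrier_mat n' m'"
    and "u \<in> carrier_vec m" "u' \<in> carrier_vec m'" "w \<in> carrier_vec m" "w' \<in> carrier_vec m'"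
  shows "rel_plus (lin_rel u w A) (lin_rel u' w' B) =
    lin_rel (u @\<^sub>v u') (0\<^sub>v m @\<^sub>v w') (row_cons (w @\<^sub>v - w') (A \<oplus>\<^sub>d B))"
proof (rule rel_eqI)
  fix x y
  have "x \<star> u + y \<star> 0\<^sub>v m + z \<star> w = x \<star> u + z \<star> w"
    "x \<star> u' + y \<star> w' + z \<star> (- w') = x \<star> u' + (y - z) \<star> w'" for z
    using assms by (auto simp: act_minus_right act_diff_left)
  then show "(x, y) \<in> rel_plus (lin_rel u w A) (lin_rel u' w' B) \<longleftrightarrow>
    (x, y) \<in> lin_rel (u @\<^sub>v u') (0\<^sub>v m @\<^sub>v w') (row_cons (w @\<^sub>v - w') (A \<oplus>\<^sub>d B))"
    using assms by (subst lin_rel_block[OF assms(1,2)]) auto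
qed

text \<open>The extra row links the blocks: its coefficient is the value at which the first relation
  ends and the second begins.\<close>

lemma lin_rel_comp:
  assumes "A \<in> carrier_mat n m" "B \<in> carrier_mat n' m'"
    and "u \<in> carrier_vec m" "u' \<in> carrier_vec m'" "w \<in> carrier_vec m" "w' \<in> carrier_vec m'"
  shows "lin_rel u w A O lin_rel u' w' B =
    lin_rel (u @\<^sub>v 0\<^sub>v m') (0\<^sub>v m @\<^sub>v w') (row_cons (w @\<^sub>v u') (A \<oplus>\<^sub>d B))"
proof (rule rel_eqI)
  fix x y
  have "x \<star> u + y \<star> 0\<^sub>v m + z \<star> w = x \<star> u + z \<star> w"
    "x \<star> 0\<^sub>v m' + y \<star> w' + z \<star> u' = z \<star> u' + y \<star> w'" for z
    using assms by (auto simp: add.commute)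
  then show "(x, y) \<in> lin_rel u w A O lin_rel u' w' B \<longleftrightarrow>
    (x, y) \<in> lin_rel (u @\<^sub>v 0\<^sub>v m') (0\<^sub>v m @\<^sub>v w') (row_cons (w @\<^sub>v u') (A \<oplus>\<^sub>d B))"
    using assms by (subst lin_rel_block[OF assms(1,2)]) (auto simp: relcomp_unfold)
qed

text \<open>The adjoined rows form a triangular pattern: the block of \<open>A\<close> is solved for
  \<open>y\<close> first, then the block of \<open>B\<close> for \<open>x\<close>. This keeps sums
  and composites inside \<open>lin_rels\<close>.\<close>

lemma full_triangular:
  assumes A: "A \<in> carrier_mat n m" and B: "B \<in> carrier_mat n' m'"
    and w: "w \<in> carrier_vec m" and u': "u' \<in> carrier_vec m'" and w': "w' \<in> carrier_vec m'"
    and full: "full w A" "full w' B"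
  shows "full (0\<^sub>v m @\<^sub>v w') (row_cons (w @\<^sub>v u') (A \<oplus>\<^sub>d B))"
proof -
  have "\<exists>x y. p + x \<star> 0\<^sub>v m + y \<star> w \<in> img A \<and> q + x \<star> w' + y \<star> u' \<in> img B"
    if p: "p \<in> carrier_vec m" and q: "q \<in> carrier_vec m'" for p q
  proof -
    obtain y where y: "p + y \<star> w \<in> img A" using full p A by (auto simp: full_def)
    have "q + y \<star> u' \<in> carrier_vec m'" using q u' by simp
    then obtain x where x: "q + y \<star> u' + x \<star> w' \<in> img B" using full B by (auto simp: full_def)
    have "p + x \<star> 0\<^sub>v m + y \<star> w = p + y \<star> w" "q + x \<star> w' + y \<star> u' = q + y \<star> u' + x \<star> w'"
      using p q w u' w' by (auto simp: ac_simps)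
    then show ?thesis using x y by metis
  qed
  then show ?thesis
    using assms by (subst full_block[OF A B]) auto
qed

definition scalar_rel :: "'r \<Rightarrow> ('m \<times> 'm) set" where
  "scalar_rel r = {(x, y). y = act x r}"

lemma scalar_rel_iff [simp]: "(x, y) \<in> scalar_rel r \<longleftrightarrow> y = act x r"
  by (simp add: scalar_rel_def)

lemma scalar_rel_in_lin_rels: "scalar_rel r \<in> lin_rels"
proof -
  define c where "c = (\<lambda>r :: 'r. vec (Suc 0) (\<lambda>_. r))"
  \<comment> \<open>The case \<open>k = 0\<close>: with no rows, \<open>Z\<close> has image 0, so
    membership in the image becomes the equation \<open>act x r - y = 0\<close>.\<close>
  define Z where "Z = (0\<^sub>m 0 (Suc 0) :: 'r mat)"
  have A: "Z \<in> carrier_mat 0 (Suc 0)" by (simp add: Z_def)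
  have "carrier_vec 0 = {vNil :: 'm vec}" by auto
  then have img: "p \<in> img Z \<longleftrightarrow> p $ 0 = 0" if "p \<in> carrier_vec (Suc 0)" for p :: "'m vec"
    using that by (auto simp: mat_image_def mat_act_def Z_def)
  have "full (c (- 1)) Z"
    unfolding full_def using img A
    by (auto simp: act_minus_right act_one c_def)
  then have "lin_rel (c r) (c (- 1)) Z \<in> lin_rels"
    by (intro lin_relsI[OF A]) (auto simp: c_def)
  moreover have "lin_rel (c r) (c (- 1)) Z = scalar_rel r"
  proof (rule rel_eqI)
    fix x y
    have "x \<star> c r + y \<star> c (- 1) \<in> carrier_vec (Suc 0)" by (auto simp: c_def)
    then show "(x, y) \<in> lin_rel (c r) (c (- 1)) Z \<longleftrightarrow> (x, y) \<in> scalar_rel r"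
      using img by (auto simp: c_def act_minus_right act_one)
  qed
  ultimately show ?thesis by simp
qed

end

section \<open>Linear relations under (A') and (B')\<close>

locale dichotomy_module = right_module act
  for act :: "'m::ab_group_add \<Rightarrow> 'r::ring_1 \<Rightarrow> 'm" +
  assumes cond_A': "cond_A' act" and cond_B': "cond_B' act"
begin

lemma not_surj: "A \<in> carrier_mat k (Suc k) \<Longrightarrow> \<exists>p \<in> carrier_vec (Suc k). p \<notin> img A"
  using cond_A'[unfolded cond_A'_def, rule_format, of "Suc k" A] mat_surj_iff[of A k "Suc k"] by auto

text \<open>\<open>row_cons v (A \<oplus>\<^sub>d B)\<close> is one row short of square, so
  \<open>full_add\<close> applies to the splitting of the adjoined vector into its two block
  components.\<close>

lemma full_block_add:
  assumes A: "A \<in> carrier_mat k (Suc k)" and B: "B \<in> carrier_mat l (Suc l)"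
    and "u \<in> carrier_vec (Suc k)" "u' \<in> carrier_vec (Suc l)"
    and "v \<in> carrier_vec (Suc k + Suc l)"
    and full: "full (u @\<^sub>v u') (row_cons v (A \<oplus>\<^sub>d B))"
  shows "full (u @\<^sub>v 0\<^sub>v (Suc l)) (row_cons v (A \<oplus>\<^sub>d B)) \<or>
    full (0\<^sub>v (Suc k) @\<^sub>v u') (row_cons v (A \<oplus>\<^sub>d B))"
proof (rule full_add[OF cond_B'])
  show "row_cons v (A \<oplus>\<^sub>d B) \<in> carrier_mat (Suc (k + l)) (Suc (Suc (k + l)))"
    using row_cons_carrier[OF mat_dsum_carrier[OF A B], of v] by simp
  have "(u @\<^sub>v 0\<^sub>v (Suc l)) + (0\<^sub>v (Suc k) @\<^sub>v u') = u @\<^sub>v u'"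
    using assms append_vec_add'[of u "Suc k" "0\<^sub>v (Suc k)" "0\<^sub>v (Suc l)" "Suc l" u'] by simp
  then show "full ((u @\<^sub>v 0\<^sub>v (Suc l)) + (0\<^sub>v (Suc k) @\<^sub>v u')) (row_cons v (A \<oplus>\<^sub>d B))"
    using full by simp
  show "u @\<^sub>v 0\<^sub>v (Suc l) \<in> carrier_vec (Suc (Suc (k + l)))"
    "0\<^sub>v (Suc k) @\<^sub>v u' \<in> carrier_vec (Suc (Suc (k + l)))"
    using append_carrier_vec[OF assms(3) zero_carrier_vec[of "Suc l"]]
      append_carrier_vec[OF zero_carrier_vec[of "Suc k"] assms(4)] by simp_all
qed

text \<open>Both adjoined rows vanish on the columns of \<open>A\<close>, so \<open>A\<close> would
  have to be onto by itself, against (A').\<close>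

lemma not_full_block:
  assumes "A \<in> carrier_mat k (Suc k)" "B \<in> carrier_mat l m"
    and "u \<in> carrier_vec m" "v \<in> carrier_vec m"
  shows "\<not> full (0\<^sub>v (Suc k) @\<^sub>v u) (row_cons (0\<^sub>v (Suc k) @\<^sub>v v) (A \<oplus>\<^sub>d B))"
proof
  assume *: "full (0\<^sub>v (Suc k) @\<^sub>v u) (row_cons (0\<^sub>v (Suc k) @\<^sub>v v) (A \<oplus>\<^sub>d B))"
  have "p \<in> img A" if p: "p \<in> carrier_vec (Suc k)" for p
  proof -
    obtain x y where "p + x \<star> 0\<^sub>v (Suc k) + y \<star> 0\<^sub>v (Suc k) \<in> img A"
      using *[unfolded full_block[OF assms(1,2) zero_carrier_vec assms(3) zero_carrier_vec assms(4)],
          rule_format, OF p zero_carrier_vec] by blast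
    then show ?thesis using p by (simp add: row_act_zero_vec)
  qed
  then show False using not_surj[OF assms(1)] by blast
qed

lemma not_full_block':
  assumes "A \<in> carrier_mat l m" "B \<in> carrier_mat k (Suc k)"
    and "u \<in> carrier_vec m" "v \<in> carrier_vec m"
  shows "\<not> full (u @\<^sub>v 0\<^sub>v (Suc k)) (row_cons (v @\<^sub>v 0\<^sub>v (Suc k)) (A \<oplus>\<^sub>d B))"
proof
  assume *: "full (u @\<^sub>v 0\<^sub>v (Suc k)) (row_cons (v @\<^sub>v 0\<^sub>v (Suc k)) (A \<oplus>\<^sub>d B))"
  have "p \<in> img B" if p: "p \<in> carrier_vec (Suc k)" for p
  proof -
    obtain x y where "p + x \<star> 0\<^sub>v (Suc k) + y \<star> 0\<^sub>v (Suc k) \<in> img B"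
      using *[unfolded full_block[OF assms(1,2,3) zero_carrier_vec assms(4) zero_carrier_vec],
          rule_format, OF zero_carrier_vec p] by blast
    then show ?thesis using p by (simp add: row_act_zero_vec)
  qed
  then show False using not_surj[OF assms(2)] by blast
qed

text \<open>
  Splitting both adjoined rows with \<open>full_add\<close> leaves four shapes; in two of them one of the diagonal
  blocks \<open>A\<close>, \<open>B\<close> would have to be onto by itself, which (A') excludes.
\<close>

lemma full_of_sum:
  assumes A: "A \<in> carrier_mat k (Suc k)" and B: "B \<in> carrier_mat l (Suc l)"
    and u: "u \<in> carrier_vec (Suc k)" and u': "u' \<in> carrier_vec (Suc l)"
    and w: "w \<in> carrier_vec (Suc k)" and w': "w' \<in> carrier_vec (Suc l)"
    and full: "full (u @\<^sub>v u') (row_cons (w @\<^sub>v w') (A \<oplus>\<^sub>d B))"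
  shows "full u A \<or> full u' B"
proof -
  let ?z = "0\<^sub>v (Suc k)" and ?z' = "0\<^sub>v (Suc l)" and ?D = "A \<oplus>\<^sub>d B"
  note D = mat_dsum_carrier[OF A B]
  note c = append_carrier_vec[of _ "Suc k" _ "Suc l"]
  note fb = full_block[OF A B]
  from full_block_add[OF A B u u' c[OF w w'] full] show ?thesis
  proof
    assume "full (u @\<^sub>v ?z') (row_cons (w @\<^sub>v w') ?D)"
    \<comment> \<open>The swap puts \<open>w @\<^sub>v w'\<close> in the position that
      \<open>full_block_add\<close> splits.\<close>
    then have "full (w @\<^sub>v w') (row_cons (u @\<^sub>v ?z') ?D)"
      by (subst full_swap[OF D]) (simp_all only: c u w w' zero_carrier_vec)
    then have "full (w @\<^sub>v ?z') (row_cons (u @\<^sub>v ?z') ?D) \<or> full (?z @\<^sub>v w') (row_cons (u @\<^sub>v ?z') ?D)"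
      by (intro full_block_add[OF A B w w'] c u zero_carrier_vec)
    then have *: "full (?z @\<^sub>v w') (row_cons (u @\<^sub>v ?z') ?D)"
      using not_full_block'[OF A B w u] by simp
    have "\<exists>y. p + y \<star> u \<in> img A" if p: "p \<in> carrier_vec (Suc k)" for p
    proof -
      obtain x y where "p + x \<star> ?z + y \<star> u \<in> img A"
        using *[unfolded fb[OF zero_carrier_vec w' u zero_carrier_vec], rule_format,
            OF p zero_carrier_vec] by blast
      then show ?thesis using p by (auto simp: row_act_zero_vec)
    qed
    then show ?thesis using A by (simp add: full_def)
  next
    assume "full (?z @\<^sub>v u') (row_cons (w @\<^sub>v w') ?D)"
    then have "full (w @\<^sub>v w') (row_cons (?z @\<^sub>v u') ?D)"
      by (subst full_swap[OF D]) (simp_all only: c u' w w' zero_carrier_vec)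
    then have "full (w @\<^sub>v ?z') (row_cons (?z @\<^sub>v u') ?D) \<or> full (?z @\<^sub>v w') (row_cons (?z @\<^sub>v u') ?D)"
      by (intro full_block_add[OF A B w w'] c u' zero_carrier_vec)
    then have *: "full (w @\<^sub>v ?z') (row_cons (?z @\<^sub>v u') ?D)"
      using not_full_block[OF A B w' u'] by simp
    have "\<exists>y. p + y \<star> u' \<in> img B" if p: "p \<in> carrier_vec (Suc l)" for p
    proof -
      obtain x y where "p + x \<star> ?z' + y \<star> u' \<in> img B"
        using *[unfolded fb[OF w zero_carrier_vec zero_carrier_vec u'], rule_format,
            OF zero_carrier_vec p] by blast
      then show ?thesis using p by (auto simp: row_act_zero_vec)
    qed
    then show ?thesis using B by (simp add: full_def)
  qed
qed

text \<open>Sums and composites are the block constructions, \<open>nonsurj_plus\<close> is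
  \<open>full_of_sum\<close> read through \<open>Range_lin_rel\<close>, and
  \<open>indeterminacy\<close> comes from (A').\<close>

sublocale division_relations lin_rels
proof
  fix f x y x' y' assume "f \<in> lin_rels" "(x, y) \<in> f" "(x', y') \<in> f"
  then show "(x - x', y - y') \<in> f"
    by (elim lin_relsE) (use lin_rel_diff in blast)
next
  fix f x assume "f \<in> lin_rels"
  then obtain k u w A where *: "A \<in> carrier_mat k (Suc k)" "u \<in> carrier_vec (Suc k)"
    "w \<in> carrier_vec (Suc k)" "full w A" "f = lin_rel u w A" by (rule lin_relsE)
  then have "x \<star> u \<in> carrier_vec (dim_col A)" by simp
  then show "\<exists>y. (x, y) \<in> f" using * unfolding full_def by auto
next
  fix f g assume "f \<in> lin_rels" "g \<in> lin_rels"
  then obtain k u w A l u' w' B where A: "A \<in> carrier_mat k (Suc k)" "u \<in> carrier_vec (Suc k)"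
    "w \<in> carrier_vec (Suc k)" "full w A" "f = lin_rel u w A"
    and B: "B \<in> carrier_mat l (Suc l)" "u' \<in> carrier_vec (Suc l)"
    "w' \<in> carrier_vec (Suc l)" "full w' B" "g = lin_rel u' w' B" by (elim lin_relsE)
  have c: "row_cons v (A \<oplus>\<^sub>d B) \<in> carrier_mat (Suc (k + l)) (Suc (Suc (k + l)))" for v
    using row_cons_carrier[OF mat_dsum_carrier[OF A(1) B(1)], of v] by simp
  have app: "p @\<^sub>v q \<in> carrier_vec (Suc (Suc (k + l)))"
    if "p \<in> carrier_vec (Suc k)" "q \<in> carrier_vec (Suc l)" for p q :: "'r vec"
    using append_carrier_vec[OF that] by simp
  have "lin_rel (u @\<^sub>v u') (0\<^sub>v (Suc k) @\<^sub>v w') (row_cons (w @\<^sub>v - w') (A \<oplus>\<^sub>d B)) \<in> lin_rels"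
    using A B by (intro lin_relsI[OF c] app full_triangular[OF A(1) B(1)]) auto
  then show "rel_plus f g \<in> lin_rels"
    using A B by (simp add: lin_rel_plus)
  have "lin_rel (u @\<^sub>v 0\<^sub>v (Suc l)) (0\<^sub>v (Suc k) @\<^sub>v w') (row_cons (w @\<^sub>v u') (A \<oplus>\<^sub>d B)) \<in> lin_rels"
    using A B by (intro lin_relsI[OF c] app full_triangular[OF A(1) B(1)]) auto
  then show "f O g \<in> lin_rels"
    using A B by (simp add: lin_rel_comp)
  assume "Range f \<noteq> UNIV" "Range g \<noteq> UNIV"
  then have "\<not> full u A" "\<not> full u' B"
    using A B Range_lin_rel by blast+
  then have "\<not> full (u @\<^sub>v u') (row_cons (w @\<^sub>v - w') (A \<oplus>\<^sub>d B))"
    using A B full_of_sum[OF A(1) B(1)] by (metis uminus_carrier_vec)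
  moreover have "Range (rel_plus f g) = UNIV \<longleftrightarrow>
      full (u @\<^sub>v u') (row_cons (w @\<^sub>v - w') (A \<oplus>\<^sub>d B))"
    unfolding A(5) B(5) lin_rel_plus[OF A(1) B(1) A(2) B(2) A(3) B(3)]
    using A B by (intro Range_lin_rel[OF c] app full_triangular[OF A(1) B(1)]) auto
  ultimately show "Range (rel_plus f g) \<noteq> UNIV" by blast
next
  fix f assume "f \<in> lin_rels"
  then obtain k u w A where *: "A \<in> carrier_mat k (Suc k)" "u \<in> carrier_vec (Suc k)"
    "w \<in> carrier_vec (Suc k)" "full w A" and f: "f = lin_rel u w A" by (rule lin_relsE)
  have "rel_neg f = lin_rel u (- w) A"
    by (rule rel_eqI) (simp add: f row_act_uminus row_act_uminus_vec)
  then show "rel_neg f \<in> lin_rels"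
    using * by (auto simp: full_uminus intro!: lin_relsI)
  show "f\<inverse> \<in> lin_rels" if "Range f = UNIV"
  proof -
    have "full u A" using that * Range_lin_rel f by blast
    \<comment> \<open>\<open>x\<close> and \<open>y\<close> enter the defining condition alike, so
      the converse exchanges \<open>u\<close> and \<open>w\<close>.\<close>
    moreover have "f\<inverse> = lin_rel w u A"
      using * by (intro rel_eqI) (simp add: f comm_add_vec[of _ "Suc k"])
    ultimately show ?thesis using * by (auto intro!: lin_relsI)
  qed
  \<comment> \<open>If 0 had every element as a value, all multiples of \<open>w\<close> would lie
    in \<open>img A\<close>, and fullness of \<open>w\<close> would make \<open>A\<close> onto,
    against (A').\<close>
  show "f `` {0} \<noteq> UNIV"
  proof
    assume "f `` {0} = UNIV"
    then have w: "0 \<star> u + y \<star> w \<in> img A" for y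
      unfolding f by (metis Image_singleton_iff UNIV_I lin_rel_iff)
    have w: "y \<star> w \<in> img A" for y
      using w[of y] * by (simp add: row_act_zero)
    have "p \<in> img A" if "p \<in> carrier_vec (Suc k)" for p
      using *(1,4) w that mem_img_cancel[OF _ w that *(1)] unfolding full_def by auto
    then show False using not_surj[OF *(1)] by blast
  qed
next
  have "Id = scalar_rel 1" "rel_zero = scalar_rel 0"
    by (auto intro!: rel_eqI simp: act_one)
  then show "Id \<in> lin_rels" and "rel_zero \<in> lin_rels"
    using scalar_rel_in_lin_rels by metis+
qed

end

section \<open>Matrix ideals and the embedding\<close>

text \<open>\<open>s\<close> is the iterated \<open>rel_plus\<close> of the relations
  \<open>g i\<close>; what is recorded of it is that it contains all pointwise sums and is still not
  onto.\<close>

lemma (in division_relations) nonsurj_combination: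
  assumes "finite I" "\<And>i. i \<in> I \<Longrightarrow> g i \<in> S" "\<And>i. i \<in> I \<Longrightarrow> Range (g i) \<noteq> UNIV"
  shows "\<exists>s \<in> S. Range s \<noteq> UNIV \<and>
    (\<forall>x y. (\<forall>i \<in> I. (x, y i) \<in> g i) \<longrightarrow> (x, \<Sum>i\<in>I. y i) \<in> s)"
  using assms
proof (induction I rule: finite_induct)
  case empty
  have "Range (rel_zero :: ('m \<times> 'm) set) \<noteq> UNIV"
    using sim_refl[OF zero_closed] unfolding rel_sim_zero .
  then show ?case using zero_closed by (intro bexI[of _ rel_zero]) auto
next
  case (insert i I)
  then obtain s where s: "s \<in> S" "Range s \<noteq> UNIV"
    "\<And>x y. \<forall>i \<in> I. (x, y i) \<in> g i \<Longrightarrow> (x, \<Sum>i\<in>I. y i) \<in> s" by auto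
  have "rel_plus (g i) s \<in> S" "Range (rel_plus (g i) s) \<noteq> UNIV"
    using insert.prems s by (intro plus_closed nonsurj_plus; simp)+
  moreover have "(x, \<Sum>i\<in>insert i I. y i) \<in> rel_plus (g i) s"
    if "\<forall>j \<in> insert i I. (x, y j) \<in> g j" for x y
    unfolding sum.insert[OF insert.hyps] using that by (intro rel_plusI s(3)) auto
  ultimately show ?case by blast
qed

section \<open>Conditions (P1), (P2), (P4) to (P7) and (E')\<close>

context right_module
begin

text \<open>A direct sum is onto exactly if both blocks are; for (P5), the block 1 is onto.\<close>

lemma P2_nonsurj: "P2 (nonsurj_mats act)"
  and P5_nonsurj: "P5 (nonsurj_mats act)"
  and P7_nonsurj: "P7 (nonsurj_mats act)"
proof -
  have sq: "A \<in> carrier_mat (dim_row A) (dim_row A)" if "square_mat A" for A :: "'r mat"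
    using that by auto
  have dsum: "A \<oplus>\<^sub>d B \<in> nonsurj_mats act \<longleftrightarrow> A \<in> nonsurj_mats act \<or> B \<in> nonsurj_mats act"
    if "square_mat A" "square_mat B" for A B
    using that mat_surj_dsum[OF sq sq, OF that] by (auto simp: nonsurj_mats_def mat_dsum_def)
  then show "P2 (nonsurj_mats act)" "P7 (nonsurj_mats act)"
    by (auto simp: P2_def P7_def nonsurj_mats_def)
  have "1\<^sub>m 1 \<notin> nonsurj_mats act" by (simp add: nonsurj_mats_def mat_surj_one)
  then show "P5 (nonsurj_mats act)"
    using dsum[of _ "1\<^sub>m 1"] by (auto simp: P5_def)
qed

lemma P6_nonsurj: "P6 (nonsurj_mats act)"
  by (simp add: P6_def nonsurj_mats_def mat_surj_one)

lemma mem_nonsurj_iff: "A \<in> carrier_mat n n \<Longrightarrow> A \<in> nonsurj_mats act \<longleftrightarrow> \<not> mat_surj act A"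
  by (auto simp: nonsurj_mats_def)

text \<open>\<open>U * V = 1\<^sub>m n\<close> makes \<open>V\<close> onto, and right multiplication
  by \<open>V\<close> recovers \<open>A\<close> from \<open>A * U\<close>; so if
  \<open>A * U\<close> were onto, \<open>A\<close> would be too.\<close>

lemma mult_invertible_nonsurj:
  assumes "A \<in> nonsurj_mats act" "A \<in> carrier_mat n n" "U \<in> carrier_mat n n" "V \<in> carrier_mat n n"
    and UV: "U * V = 1\<^sub>m n"
  shows "A * U \<in> nonsurj_mats act"
proof -
  have "mat_surj act A" if "mat_surj act (A * U)"
  proof -
    have "mat_surj act (A * U * V)"
      using that mat_surj_invertible[OF assms(3,4) UV] assms
      by (intro mat_surj_mult(2)[of "A * U" n n V n]) auto
    also have "A * U * V = A"
      using assms by (simp add: assoc_mult_mat[of A n n U n V n])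
    finally show ?thesis .
  qed
  then show ?thesis
    using assms mem_nonsurj_iff[of A n] mem_nonsurj_iff[of "A * U" n] by auto
qed

lemma mat_unit_square:
  assumes "i < n" "j < n" "i \<noteq> j"
  shows "mat_unit n i j * mat_unit n i j = (0\<^sub>m n n :: 'r mat)"
proof (rule eq_matI)
  fix k l assume "k < dim_row (0\<^sub>m n n :: 'r mat)" "l < dim_col (0\<^sub>m n n :: 'r mat)"
  then have "k < n" "l < n" by auto
  moreover have "(if k = i \<and> m = j then 1 else 0) * (if m = i \<and> l = j then 1 else 0) = (0::'r)" for m
    using assms by auto
  ultimately show "(mat_unit n i j * mat_unit n i j) $$ (k, l) = (0\<^sub>m n n :: 'r mat) $$ (k, l)"
    by (simp add: mat_unit_def scalar_prod_def)
qed (auto simp: mat_unit_def)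

text \<open>The square of a matrix unit off the diagonal vanishes, so the two factors invert each
  other.\<close>

lemma elementary_inverse:
  assumes "i < n" "j < n" "i \<noteq> j"
  shows "(1\<^sub>m n + mat_unit n i j) * (1\<^sub>m n - mat_unit n i j) = (1\<^sub>m n :: 'r mat)"
    and "(1\<^sub>m n - mat_unit n i j) * (1\<^sub>m n + mat_unit n i j) = (1\<^sub>m n :: 'r mat)"
proof -
  let ?E = "mat_unit n i j :: 'r mat"
  have E: "?E \<in> carrier_mat n n" by (simp add: mat_unit_def)
  have "(1\<^sub>m n + ?E) * (1\<^sub>m n - ?E) = 1\<^sub>m n + ?E - ?E"
    using E by (simp add: add_mult_distrib_mat[of _ n n _ _ n] mult_minus_distrib_mat[of _ n n _ n]
        mat_unit_square[OF assms])
  also have "\<dots> = 1\<^sub>m n" using E by (intro eq_matI) auto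
  finally show "(1\<^sub>m n + ?E) * (1\<^sub>m n - ?E) = 1\<^sub>m n" .
  have "(1\<^sub>m n - ?E) * (1\<^sub>m n + ?E) = 1\<^sub>m n + ?E - ?E"
    using E by (simp add: minus_mult_distrib_mat[of _ n n _ _ n] mult_add_distrib_mat[of _ n n _ n]
        mat_unit_square[OF assms])
  also have "\<dots> = 1\<^sub>m n" using E by (intro eq_matI) auto
  finally show "(1\<^sub>m n - ?E) * (1\<^sub>m n + ?E) = 1\<^sub>m n" .
qed

lemma cond_E'_nonsurj: "cond_E' (nonsurj_mats act)"
  unfolding cond_E'_def
proof (intro allI ballI impI conjI)
  fix n i j :: nat and A :: "'r mat"
  assume *: "A \<in> nonsurj_mats act \<inter> carrier_mat n n" "i < n" "j < n" "i \<noteq> j"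
  have E: "(mat_unit n i j :: 'r mat) \<in> carrier_mat n n" by (simp add: mat_unit_def)
  show "A * (1\<^sub>m n + mat_unit n i j) \<in> nonsurj_mats act"
    using * E elementary_inverse(1)[of i n j]
    by (intro mult_invertible_nonsurj[where V = "1\<^sub>m n - mat_unit n i j" and n = n]) auto
  show "A * (1\<^sub>m n - mat_unit n i j) \<in> nonsurj_mats act"
    using * E elementary_inverse(2)[of i n j]
    by (intro mult_invertible_nonsurj[where V = "1\<^sub>m n + mat_unit n i j" and n = n]) auto
qed

text \<open>If \<open>B * C\<close> is onto then so is \<open>C\<close>, which (A') forbids.
  Conversely, a \<open>C\<close> violating (A') has an onto product with any onto
  \<open>B\<close>.\<close>

lemma P1_nonsurj_iff: "P1 (nonsurj_mats act) \<longleftrightarrow> cond_A' act"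
proof
  assume P1: "P1 (nonsurj_mats act)"
  show "cond_A' act"
    unfolding cond_A'_def
  proof (intro allI ballI impI notI)
    fix n :: nat and C
    assume n: "0 < n" and C: "C \<in> carrier_mat (n - 1) n" and surj: "mat_surj act C"
    obtain k where k: "n = Suc k" using n by (cases n) auto
    \<comment> \<open>The identity below a zero row: it drops the first coordinate, hence is onto,
      and has the shape required of the left factor in (P1).\<close>
    define B :: "'r mat" where "B = row_cons (0\<^sub>v k) (1\<^sub>m k)"
    have C: "C \<in> carrier_mat k (Suc k)" and B: "B \<in> carrier_mat (Suc k) k"
      using C k row_cons_carrier[of "1\<^sub>m k :: 'r mat" k k] by (auto simp: B_def)
    have "mat_surj act B"
    proof -
      have "p \<in> img B" if "p \<in> carrier_vec k" for p
      proof -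
        have "p + 0 \<star> 0\<^sub>v k \<in> img (1\<^sub>m k)"
          using that mat_surj_one[of k] by (simp add: mat_surj_iff[OF one_carrier_mat] row_act_zero)
        then show ?thesis
          unfolding B_def using that mem_img_row_cons[OF one_carrier_mat zero_carrier_vec] by blast
      qed
      then show ?thesis using mat_surj_iff[OF B] by blast
    qed
    then have "mat_surj act (B * C)" using mat_surj_mult(2)[OF B C] surj by blast
    moreover have "B * C \<in> nonsurj_mats act"
      using P1[unfolded P1_def, rule_format, OF n, of B C] B C k by simp
    ultimately show False by (simp add: nonsurj_mats_def)
  qed
next
  assume A': "cond_A' act"
  show "P1 (nonsurj_mats act)"
    unfolding P1_def
  proof (intro allI ballI impI)
    fix n :: nat and B C :: "'r mat"
    assume n: "0 < n" and B: "B \<in> carrier_mat n (n - 1)" and C: "C \<in> carrier_mat (n - 1) n"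
    have "\<not> mat_surj act C" using A' n C unfolding cond_A'_def by blast
    then have "\<not> mat_surj act (B * C)" using mat_surj_mult(1)[OF B C] by blast
    then show "B * C \<in> nonsurj_mats act" using B C by (auto simp: nonsurj_mats_def)
  qed
qed

text \<open>Both matrices and their determinantal sum become the same matrix once row
  \<open>r\<close> is deleted, so the claim is \<open>full_add\<close> for the deleted rows.\<close>

lemma P4_nonsurj:
  assumes "cond_B' act"
  shows "P4 (nonsurj_mats act)"
  unfolding P4_def
proof (intro allI ballI impI)
  fix n r and A B :: "'r mat"
  assume A: "A \<in> nonsurj_mats act \<inter> carrier_mat n n" and B: "B \<in> nonsurj_mats act \<inter> carrier_mat n n"
    and r: "r < n" and agree: "agree_off_row r A B"
  obtain k where k: "n = Suc k" "r \<le> k" using r by (cases n) auto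
  let ?C = "det_sum_row r A B"
  have c: "A \<in> carrier_mat (Suc k) (Suc k)" "B \<in> carrier_mat (Suc k) (Suc k)"
    "?C \<in> carrier_mat (Suc k) (Suc k)"
    using A B k by (auto simp: det_sum_row_def)
  have rc: "row A r \<in> carrier_vec (Suc k)" "row B r \<in> carrier_vec (Suc k)"
    using c(1,2) by (auto intro!: carrier_vecI)
  have row: "row ?C r = row A r + row B r"
    using c k by (auto simp: det_sum_row_def)
  have del: "del_row r ?C = del_row r A" "del_row r B = del_row r A"
    using c k agree
    by (auto simp: del_row_def det_sum_row_def agree_off_row_def insert_index_def)
  have "mat_surj act A \<or> mat_surj act B" if "mat_surj act ?C"
    using that full_add[OF assms del_row_carrier[OF c(1)] rc] c
    by (simp add: mat_surj_row[OF _ k(2)] row del)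
  then show "?C \<in> nonsurj_mats act"
    using A B c k by (auto simp: mem_nonsurj_iff)
qed

end

section \<open>The column condition (P3)\<close>

context dichotomy_module
begin

text \<open>
  Writing \<open>x \<star> e\<close> as a combination of the rows of \<open>C\<close>, the coefficient of the \<open>i\<close>-th row is a
  relation in \<open>x\<close> which is onto precisely if \<open>e\<close> can replace that row. If no coefficient were onto,
  neither would be the identity, which is contained in the \<open>r\<close>-th entry of the combination.
\<close>

lemma exchange:
  assumes C: "C \<in> carrier_mat (Suc k) (Suc k)" and surj: "mat_surj act C" and r: "r < Suc k"
  obtains i where "i \<le> k" "full (unit_vec (Suc k) r) (del_row i C)"
proof (rule ccontr)
  note found = that
  assume neg: "\<not> thesis"
  have none: "\<not> full (unit_vec (Suc k) r) (del_row i C)" if "i \<le> k" for i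
    using found[OF that] neg by blast
  let ?e = "unit_vec (Suc k) r :: 'r vec"
  \<comment> \<open>The sign makes \<open>y\<close> the coefficient of row \<open>i\<close> in an
    expression of \<open>x \<star> ?e\<close> by the rows of \<open>C\<close>.\<close>
  define g where "g i = lin_rel ?e (- row C i) (del_row i C)" for i
  have row: "row C i \<in> carrier_vec (Suc k)" "- row C i \<in> carrier_vec (Suc k)" for i
    using C by (auto intro!: carrier_vecI)
  have full: "full (- row C i) (del_row i C)" if "i \<le> k" for i
    using surj mat_surj_row[OF C that] by (simp add: full_uminus)
  have g: "g i \<in> lin_rels" "Range (g i) \<noteq> UNIV" if "i \<le> k" for i
    using that none full row
    by (auto simp: g_def Range_lin_rel[OF del_row_carrier[OF C]] intro!: lin_relsI[OF del_row_carrier[OF C]])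
  \<comment> \<open>The contribution of row \<open>i\<close> to coordinate \<open>r\<close>: the
    coefficient of that row times its entry in column \<open>r\<close>.\<close>
  define h where "h i = g i O scalar_rel (C $$ (i, r))" for i
  have h: "h i \<in> lin_rels" "Range (h i) \<noteq> UNIV" if "i \<le> k" for i
    using comp_closed[OF g(1)[OF that] scalar_rel_in_lin_rels]
      nonsurj_comp_right[OF g(2)[OF that] g(1)[OF that] scalar_rel_in_lin_rels]
    unfolding h_def .
  have "\<exists>s \<in> lin_rels. Range s \<noteq> UNIV \<and>
      (\<forall>x y. (\<forall>i \<in> {..<Suc k}. (x, y i) \<in> h i) \<longrightarrow> (x, \<Sum>i<Suc k. y i) \<in> s)"
    by (rule nonsurj_combination)
      (auto simp only: finite_lessThan lessThan_iff less_Suc_eq_le h)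
  then obtain s where "Range s \<noteq> UNIV"
    and "\<forall>x y. (\<forall>i \<in> {..<Suc k}. (x, y i) \<in> h i) \<longrightarrow> (x, \<Sum>i<Suc k. y i) \<in> s" by blast
  note s = this(1) this(2)[rule_format]
  have "(x, x) \<in> s" for x
  proof -
    have "x \<star> ?e \<in> img C" using surj by (simp add: mat_surj_iff[OF C])
    then obtain v where v: "v \<in> carrier_vec (Suc k)" "mat_act act C v = x \<star> ?e"
      using C by (auto simp: mat_image_def)
    have "(x, act (v $ i) (C $$ (i, r))) \<in> h i" if i: "i \<le> k" for i
    proof -
      let ?w = "mat_act act (del_row i C) (vec k (\<lambda>j. v $ insert_index i j))"
      have w: "?w \<in> img (del_row i C)"
        using C by (auto simp: mat_image_def del_row_def)
      have eq: "x \<star> ?e = (v $ i) \<star> row C i + ?w"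
        using mat_act_del_row[OF C i v(1)] v(2) by simp
      have "a + b + - a = b" if "a \<in> carrier_vec (Suc k)" "b \<in> carrier_vec (Suc k)" for a b :: "'m vec"
        using that by auto
      from this[of "(v $ i) \<star> row C i" ?w] have "x \<star> ?e + (v $ i) \<star> (- row C i) = ?w"
        unfolding eq row_act_uminus_vec using row(1)[of i] imgD[OF w del_row_carrier[OF C]] by simp
      then have "(x, v $ i) \<in> g i" using w by (simp add: g_def)
      then show ?thesis unfolding h_def by (rule relcomp.relcompI) simp
    qed
    then have "(x, \<Sum>i<Suc k. act (v $ i) (C $$ (i, r))) \<in> s" by (intro s(2)) simp
    moreover have "(\<Sum>i<Suc k. act (v $ i) (C $$ (i, r))) = mat_act act C v $ r"
      using C r by (simp add: mat_act_def)
    ultimately show ?thesis using v r by (simp add: act_one)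
  qed
  then show False using s(1) by blast
qed

text \<open>The two outputs differ only in coordinate \<open>r\<close>, so their difference is a
  multiple of the unit vector there.\<close>

lemma agree_off_col_act:
  assumes "A \<in> carrier_mat n m" "B \<in> carrier_mat n m" "agree_off_col r A B" "r < m"
    and "v \<in> carrier_vec n"
  shows "mat_act act A v = mat_act act B v + (mat_act act A v $ r - mat_act act B v $ r) \<star> unit_vec m r"
  using assms by (auto simp: mat_act_def agree_off_col_def act_one unit_vec_def)

text \<open>Changing column \<open>r\<close> alters an output only by a multiple of
  \<open>unit_vec m r\<close>, which the coefficient of that adjoined row absorbs.\<close>

lemma agree_off_col_full:
  assumes A: "A \<in> carrier_mat n m" and B: "B \<in> carrier_mat n m" and agree: "agree_off_col r A B"
    and r: "r < m" and full: "full (unit_vec m r) B"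
  shows "full (unit_vec m r) A"
  unfolding full_def
proof
  let ?e = "unit_vec m r"
  fix p :: "'m vec" assume "p \<in> carrier_vec (dim_col A)"
  then have p: "p \<in> carrier_vec m" using A by simp
  then obtain x v where v: "v \<in> carrier_vec n" "p + x \<star> ?e = mat_act act B v"
    using full B by (auto simp: full_def mat_image_def)
  let ?d = "mat_act act A v $ r - mat_act act B v $ r"
  have "mat_act act A v = (p + x \<star> ?e) + ?d \<star> ?e"
    using agree_off_col_act[OF A B agree r v(1)] v(2) by simp
  also have "\<dots> = p + (x + ?d) \<star> ?e"
    using p by (auto simp: act_add_left act_diff_left)
  finally have "p + (x + ?d) \<star> ?e \<in> img A" using v A by (auto simp: mat_image_def)
  then show "\<exists>x. p + x \<star> ?e \<in> img A" by blast
qed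

lemma P3_nonsurj: "P3 (nonsurj_mats act)"
  unfolding P3_def
proof (intro allI ballI impI)
  fix n r and A B :: "'r mat"
  assume A: "A \<in> nonsurj_mats act \<inter> carrier_mat n n" and B: "B \<in> nonsurj_mats act \<inter> carrier_mat n n"
    and r: "r < n" and agree: "agree_off_col r A B"
  obtain k where k: "n = Suc k" "r \<le> k" using r by (cases n) auto
  define C where "C = det_sum_col r A B"
  let ?e = "unit_vec (Suc k) r :: 'r vec"
  have c: "A \<in> carrier_mat (Suc k) (Suc k)" "B \<in> carrier_mat (Suc k) (Suc k)"
    "C \<in> carrier_mat (Suc k) (Suc k)"
    using A B k by (auto simp: det_sum_col_def C_def)
  have "False" if surj: "mat_surj act C"
  proof -
    \<comment> \<open>Row \<open>i\<close> of \<open>C\<close> can be replaced by the unit vector.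
      With row \<open>i\<close> deleted, the three matrices differ only in column \<open>r\<close>,
      so the same \<open>i\<close> serves \<open>A\<close> and \<open>B\<close>.\<close>
    obtain i where i: "i \<le> k" "full ?e (del_row i C)"
      using exchange[OF c(3) surj] k by (metis le_imp_less_Suc)
    note d = del_row_carrier[of _ k "Suc k" i]
    have agree_del: "agree_off_col r (del_row i A) (del_row i C)"
      "agree_off_col r (del_row i B) (del_row i C)"
      using agree c i by (auto simp: agree_off_col_def del_row_def C_def det_sum_col_def
          insert_index_def)
    have full: "full (- ?e) (del_row i A)" "full (- ?e) (del_row i B)" "full (- ?e) (del_row i C)"
      using agree_off_col_full[OF d[OF c(1)] d[OF c(3)] agree_del(1) _ i(2)]
        agree_off_col_full[OF d[OF c(2)] d[OF c(3)] agree_del(2) _ i(2)] i(2) k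
      by (simp_all add: full_uminus)
    have e: "- ?e \<in> carrier_vec (Suc k)" by simp
    have row: "row M i \<in> carrier_vec (Suc k)" if "M \<in> carrier_mat (Suc k) (Suc k)" for M :: "'r mat"
      using that by (intro carrier_vecI) simp
    \<comment> \<open>\<open>y\<close> is a multiple of the unit vector whose subtraction brings
      \<open>x \<star> row M i\<close> into the image of the other rows. By
      \<open>Range_lin_rel\<close> this relation is onto exactly if \<open>M\<close> acts
      surjectively.\<close>
    let ?f = "\<lambda>M. lin_rel (row M i) (- ?e) (del_row i M)"
    have f: "?f M \<in> lin_rels" "Range (?f M) = UNIV \<longleftrightarrow> mat_surj act M"
      if "full (- ?e) (del_row i M)" "M \<in> carrier_mat (Suc k) (Suc k)" for M
      using lin_relsI[OF d[OF that(2)] row[OF that(2)] e that(1)]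
        Range_lin_rel[OF d[OF that(2)] row[OF that(2)] e that(1)] mat_surj_row[OF that(2) i(1)]
      by auto
    have "Range (rel_plus (?f A) (?f B)) \<noteq> UNIV"
      using f[OF full(1) c(1)] f[OF full(2) c(2)] A B
      by (intro nonsurj_plus) (auto simp: nonsurj_mats_def)
    moreover have "?f C \<subseteq> rel_plus (?f A) (?f B)"
    proof clarify
      fix x y assume "(x, y) \<in> ?f C"
      then obtain v where v: "v \<in> carrier_vec k"
        and eq: "x \<star> row C i + y \<star> (- ?e) = mat_act act (del_row i C) v"
        using d[OF c(3)] by (auto simp: mat_image_def)
      \<comment> \<open>For the fixed combination \<open>v\<close> of the remaining rows,
        \<open>z M\<close> is the discrepancy in coordinate \<open>r\<close>, the only column in
        which the matrices differ. It is additive in that column, so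
        \<open>z A + z B = y\<close>.\<close>
      define z where "z M = act x (M $$ (i, r)) - mat_act act (del_row i M) v $ r" for M
      have z: "(x, z M) \<in> ?f M"
        if M: "M \<in> carrier_mat (Suc k) (Suc k)"
          and off: "\<And>i j. i \<le> k \<Longrightarrow> j \<le> k \<Longrightarrow> j \<noteq> r \<Longrightarrow> M $$ (i, j) = C $$ (i, j)" for M
      proof -
        have "x \<star> row M i + z M \<star> (- ?e) = mat_act act (del_row i M) v"
        proof (rule eq_vecI)
          fix j assume "j < dim_vec (mat_act act (del_row i M) v)"
          then have j: "j \<le> k" using d[OF M] by (simp add: mat_act_def)
          show "(x \<star> row M i + z M \<star> (- ?e)) $ j = mat_act act (del_row i M) v $ j"
          proof (cases "j = r")
            case True
            then show ?thesis using M j i by (simp add: z_def act_minus_right act_one)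
          next
            case False
            have "mat_act act (del_row i M) v $ j = mat_act act (del_row i C) v $ j"
              using M c j i False
              by (auto simp: mat_act_def del_row_def off insert_index_def intro!: sum.cong)
            also have "\<dots> = (x \<star> row C i + y \<star> (- ?e)) $ j" using eq by simp
            also have "\<dots> = (x \<star> row M i + z M \<star> (- ?e)) $ j"
              using M c j i False k by (simp add: off)
            finally show ?thesis by simp
          qed
        qed (use d[OF M] M in \<open>simp add: mat_act_def\<close>)
        then show ?thesis
          using v d[OF M] by (auto simp: mat_image_def)
      qed
      have "A $$ (i, j) = C $$ (i, j)" "B $$ (i, j) = C $$ (i, j)"
        if "i \<le> k" "j \<le> k" "j \<noteq> r" for i j
        using c agree that by (auto simp: C_def det_sum_col_def agree_off_col_def)
      then have "(x, z A) \<in> ?f A" "(x, z B) \<in> ?f B"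
        using z[OF c(1)] z[OF c(2)] by blast+
      then have "(x, z A + z B) \<in> rel_plus (?f A) (?f B)" by (rule rel_plusI)
      moreover have "z A + z B = y"
      proof -
        have "y = act x (C $$ (i, r)) - mat_act act (del_row i C) v $ r"
          using arg_cong[OF eq, of "\<lambda>v. v $ r"] c i k
          by (simp add: act_minus_right act_one algebra_simps)
        also have "\<dots> = z A + z B"
          using c i k v d[OF c(3)]
          by (simp add: z_def mat_act_def del_row_def C_def det_sum_col_def act_add_right
              sum.distrib insert_index_def)
        finally show ?thesis by simp
      qed
      ultimately show "(x, y) \<in> rel_plus (?f A) (?f B)" by simp
    qed
    moreover have "Range (?f C) = UNIV" using f[OF full(3) c(3)] surj by simp
    ultimately show False by blast
  qed
  then show "det_sum_col r A B \<in> nonsurj_mats act"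
    using c by (auto simp: C_def mem_nonsurj_iff)
qed

section \<open>The prime matrix ideal and the embedding\<close>

lemma prime_matrix_ideal_nonsurj: "prime_matrix_ideal (nonsurj_mats act)"
  unfolding prime_matrix_ideal_def
  using cond_A' cond_B' P1_nonsurj_iff P2_nonsurj P3_nonsurj P4_nonsurj P5_nonsurj P6_nonsurj P7_nonsurj
  by (auto simp: nonsurj_mats_def)

text \<open>
  The division ring is to live on sets of matrices over \<open>R\<close>, so the data of a relation are stacked
  into one matrix and a class of relations is replaced by the set of all matrices defining its
  members.
\<close>

definition mat_rel :: "'r mat \<Rightarrow> ('m \<times> 'm) set" where
  "mat_rel M = lin_rel (row M 0) (row M 1) (del_row 0 (del_row 0 M))"

definition rel_class :: "('m \<times> 'm) set \<Rightarrow> 'r mat set" where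
  "rel_class f = {M. mat_rel M \<in> lin_rels \<and> rel_sim (mat_rel M) f}"

lemma mat_rel_surj:
  assumes "f \<in> lin_rels"
  obtains M where "mat_rel M = f"
proof -
  obtain k u w A where A: "A \<in> carrier_mat k (Suc k)" "u \<in> carrier_vec (Suc k)"
    "w \<in> carrier_vec (Suc k)" "f = lin_rel u w A"
    using assms by (rule lin_relsE)
  let ?M = "row_cons u (row_cons w A)"
  have "row ?M 0 = u" "row ?M 1 = w" "del_row 0 (del_row 0 ?M) = A"
    using A by (auto simp: row_row_cons del_row_row_cons) (auto simp: row_cons_def)
  then have "mat_rel ?M = f" using A by (simp add: mat_rel_def)
  then show thesis by (rule that)
qed

text \<open>A matrix presenting \<open>f\<close> lies in the class of \<open>f\<close>, so equal
  classes force similarity.\<close>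

lemma rel_class_eq:
  assumes "f \<in> lin_rels" "g \<in> lin_rels"
  shows "rel_class f = rel_class g \<longleftrightarrow> rel_sim f g"
proof
  assume eq: "rel_class f = rel_class g"
  obtain M where M: "mat_rel M = f" using mat_rel_surj[OF assms(1)] .
  then have "M \<in> rel_class f" using assms sim_refl by (simp add: rel_class_def)
  then show "rel_sim f g" unfolding eq using M by (simp add: rel_class_def)
next
  assume "rel_sim f g"
  then show "rel_class f = rel_class g"
    unfolding rel_class_def using assms sim_trans rel_sim_sym by blast
qed

sublocale quot: division_relations_quotient lin_rels rel_class
  by unfold_locales (rule rel_class_eq)

text \<open>Right scalars compose left to right, so \<open>scalar_rel\<close> is multiplicative. The
  difference of the relations of distinct \<open>r\<close> and \<open>s\<close> contains
  multiplication by \<open>r - s\<close>, which is onto, so their classes are distinct.\<close>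

lemma embeddable:
  assumes "\<And>r :: 'r. r \<noteq> 0 \<Longrightarrow> surj (\<lambda>x. act x r)"
  shows "embeddable_in_division_ring TYPE('r)"
proof -
  let ?h = "\<lambda>r. rel_class (scalar_rel r)"
  note S = scalar_rel_in_lin_rels
  have "scalar_rel (r * s) = scalar_rel r O scalar_rel s"
    "scalar_rel (r + s) = rel_plus (scalar_rel r) (scalar_rel s)" for r s :: 'r
    by (auto intro!: rel_eqI simp: act_mult act_add_right relcomp_unfold algebra_simps)
  moreover have "scalar_rel 1 = Id"
    by (auto intro!: rel_eqI simp: act_one)
  ultimately have "?h \<in> Ring.ring_hom class_ring quot.quot"
    by (intro Ring.ring_hom_memI)
      (simp_all add: quot.carrier_quot quot.mult_cls quot.add_cls quot.one_quot S)
  moreover have "inj ?h"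
  proof (rule injI, rule ccontr)
    fix r s assume eq: "?h r = ?h s" and "r \<noteq> s"
    then have "surj (\<lambda>x. act x (r - s))" using assms by simp
    moreover have "(x, act x (r - s)) \<in> rel_plus (scalar_rel r) (rel_neg (scalar_rel s))" for x
      using act_add_right[of x r "- s"] by (simp add: act_minus_right)
    ultimately have "Range (rel_plus (scalar_rel r) (rel_neg (scalar_rel s))) = UNIV"
      unfolding surj_def by (metis (no_types, lifting) Range.intros UNIV_eq_I)
    then show False using eq by (simp add: rel_class_eq S rel_sim_def)
  qed
  ultimately show ?thesis
    unfolding embeddable_in_division_ring_def using quot.skew_field_quot by blast
qed

end

theorem lemma20:
  fixes act :: "'m::ab_group_add \<Rightarrow> 'r::ring_1 \<Rightarrow> 'm"
  assumes "right_module act"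
    and "\<exists>x::'m. x \<noteq> 0"
  shows "(P2 (nonsurj_mats act) \<and> P5 (nonsurj_mats act) \<and> P6 (nonsurj_mats act) \<and>
      P7 (nonsurj_mats act) \<and> cond_E' (nonsurj_mats act)) \<and>
    (P1 (nonsurj_mats act) \<longleftrightarrow> cond_A' act) \<and>
    (cond_B' act \<longrightarrow> P4 (nonsurj_mats act)) \<and>
    (cond_A' act \<and> cond_B' act \<longrightarrow> prime_matrix_ideal (nonsurj_mats act)) \<and>
    (cond_A' act \<and> cond_B' act \<and> (\<forall>r::'r. r \<noteq> 0 \<longrightarrow> surj (\<lambda>x. act x r)) \<longrightarrow>
      embeddable_in_division_ring TYPE('r))"
proof -
  interpret right_module act by fact
  have "dichotomy_module act" if "cond_A' act" "cond_B' act"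
    using that by unfold_locales
  then show ?thesis
    using P2_nonsurj P5_nonsurj P6_nonsurj P7_nonsurj cond_E'_nonsurj P1_nonsurj_iff P4_nonsurj
      dichotomy_module.prime_matrix_ideal_nonsurj dichotomy_module.embeddable
    by blast
qed

end
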